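(* Let $G$ be a bi-orderable group. (i) If $G$ is not virtually abelian, then $\mathrm{Comm}(G)$ acts faithfully on $\mathrm{VLO}(G)$. (ii) If $G$ is virtually abelian, then the kernel of the action of $\mathrm{Comm}(G)$ on $\mathrm{VLO}(G)$ consists precisely of the elements represented by commensurations of the form $\tau_{p/q}:H_1\rightarrow H_2$, where $H_1,H_2$ are finite index abelian subgroups of $G$ and $p/q$ is a positive rational for which such an isomorphism $\tau_{p/q}$ exists.
   Context: A left-ordering of a group $G$ is a strict total ordering $<$ of $G$ such that $g<h$ implies $fg<fh$ for all $f,g,h\in G$; it is a bi-ordering if moreover $g<h$ implies $gf<hf$. $G$ is bi-orderable if it admits a bi-ordering. Left-orderings are identified with their positive cones $P=\{g\in G\mid g>1\}$, which are exactly the subsets $P\subset G$ with $P\cdot P\subset P$ and $G=P\sqcup P^{-1}\sqcup\{1\}$; $\mathrm{LO}(G)$ is the set of all positive cones of left-orderings of $G$. A commensuration of $G$ is an isomorphism $\phi:H_1\rightarrow H_2$ between finite index subgroups $H_1,H_2\subset G$. Two commensurations $\phi:H_1\to H_2$ and $\phi':H_1'\to H_2'$ are equivalent if there is a finite index subgroup $H\subset H_1\cap H_1'$ with $\phi|_H=\phi'|_H$. The equivalence classes form the commensurator group $\mathrm{Comm}(G)$ (under composition on suitable finite index subgroups). The space of virtual left-orderings of $G$ is $\mathrm{VLO}(G)=\varinjlim \mathrm{LO}(H)$, the direct limit over all finite index subgroups $H$ of $G$ with respect to the restriction maps $\mathrm{LO}(H)\to\mathrm{LO}(H')$, $P\mapsto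 P\cap H'$, for $H'\subset H$. For $P\in\mathrm{LO}(H)$ with $H$ of finite index in $G$, $[P]$ denotes its class in $\mathrm{VLO}(G)$. $\mathrm{Comm}(G)$ acts on $\mathrm{VLO}(G)$ by $\phi([P])=[\phi(P\cap H_1)]$ for $\phi:H_1\to H_2$ a commensuration and $P\in\mathrm{LO}(H)$. For finite index abelian subgroups $H_1,H_2$ of $G$ and positive integers $p,q$, $\tau_{p/q}:H_1\to H_2$ denotes the isomorphism satisfying $\tau_{p/q}(g^q)=g^p$ for all $g\in H_1$, when it exists. *)

theory Defs
  imports "HOL-Algebra.Algebra"
begin

text \<open>Orderings are strict relations on the carrier; their values off the carrier are irrelevant.\<close>

definition left_ordering :: "('a, 'b) monoid_scheme \<Rightarrow> ('a \<Rightarrow> 'a \<Rightarrow> bool) \<Rightarrow> bool" where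
  "left_ordering G lt \<longleftrightarrow>
     irreflp_on (carrier G) lt \<and> transp_on (carrier G) lt \<and> totalp_on (carrier G) lt \<and>
     (\<forall>f\<in>carrier G. \<forall>g\<in>carrier G. \<forall>h\<in>carrier G. lt g h \<longrightarrow> lt (f \<otimes>\<^bsub>G\<^esub> g) (f \<otimes>\<^bsub>G\<^esub> h))"

definition bi_ordering :: "('a, 'b) monoid_scheme \<Rightarrow> ('a \<Rightarrow> 'a \<Rightarrow> bool) \<Rightarrow> bool" where
  "bi_ordering G lt \<longleftrightarrow> left_ordering G lt \<and>
     (\<forall>f\<in>carrier G. \<forall>g\<in>carrier G. \<forall>h\<in>carrier G. lt g h \<longrightarrow> lt (g \<otimes>\<^bsub>G\<^esub> f) (h \<otimes>\<^bsub>G\<^esub> f))"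

definition bi_orderable :: "('a, 'b) monoid_scheme \<Rightarrow> bool" where
  "bi_orderable G \<longleftrightarrow> (\<exists>lt. bi_ordering G lt)"

definition positive_cone :: "('a, 'b) monoid_scheme \<Rightarrow> ('a \<Rightarrow> 'a \<Rightarrow> bool) \<Rightarrow> 'a set" where
  "positive_cone G lt = {g \<in> carrier G. lt \<one>\<^bsub>G\<^esub> g}"

definition LO :: "('a, 'b) monoid_scheme \<Rightarrow> 'a set set" where
  "LO G = {positive_cone G lt |lt. left_ordering G lt}"

lemma (in group) LO_iff:
  "P \<in> LO G \<longleftrightarrow> P \<subseteq> carrier G \<and> P <#> P \<subseteq> P \<and>
     carrier G = P \<union> m_inv G ` P \<union> {\<one>} \<and>
     P \<inter> m_inv G ` P = {} \<and> \<one> \<notin> P \<and> \<one> \<notin> m_inv G ` P"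
  (is "_ \<longleftrightarrow> ?R")
proof
  assume "P \<in> LO G"
  then obtain lt where lo: "left_ordering G lt" and P: "P = positive_cone G lt"
    by (auto simp: LO_def)
  have irr: "\<not> lt x x" if "x \<in> carrier G" for x
    using lo that by (auto simp: left_ordering_def irreflp_on_def)
  have tr: "lt x z" if "lt x y" "lt y z" "x \<in> carrier G" "y \<in> carrier G" "z \<in> carrier G" for x y z
    using lo that unfolding left_ordering_def transp_on_def by blast
  have tot: "lt x y \<or> lt y x" if "x \<noteq> y" "x \<in> carrier G" "y \<in> carrier G" for x y
    using lo that unfolding left_ordering_def totalp_on_def by blast
  have inv: "lt (f \<otimes> g) (f \<otimes> h)"
    if "lt g h" "f \<in> carrier G" "g \<in> carrier G" "h \<in> carrier G" for f g h
    using lo that unfolding left_ordering_def by blast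
  have sub: "P \<subseteq> carrier G" and one: "\<one> \<notin> P"
    using irr by (auto simp: P positive_cone_def)
  have mult: "x \<otimes> y \<in> P" if "x \<in> P" "y \<in> P" for x y
    using that inv[of \<one> y x] tr[of \<one> x "x \<otimes> y"] by (auto simp: P positive_cone_def)
  have cover: "x \<in> P \<union> m_inv G ` P \<union> {\<one>}" if x: "x \<in> carrier G" for x
  proof (cases "x = \<one> \<or> lt \<one> x")
    case True
    then show ?thesis using x by (auto simp: P positive_cone_def)
  next
    case False
    then have "lt x \<one>" using tot x by auto
    then have "inv x \<in> P" using inv[of x \<one> "inv x"] x by (auto simp: P positive_cone_def)
    then have "inv (inv x) \<in> m_inv G ` P" by blast
    then show ?thesis using x by simp
  qed
  have disj: "inv x \<notin> P" if "x \<in> P" for x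
    using mult[OF that, of "inv x"] that one sub by auto
  show ?R
    using sub one mult cover disj
    by (auto simp: set_mult_def subset_iff) (metis inv_one inv_inv)
next
  assume R: ?R
  then have sub: "P \<subseteq> carrier G" and mult: "\<And>x y. x \<in> P \<Longrightarrow> y \<in> P \<Longrightarrow> x \<otimes> y \<in> P"
    by (auto simp: set_mult_def)
  have canc: "x \<otimes> (inv x \<otimes> y) = y" if "x \<in> carrier G" "y \<in> carrier G" for x y
    using that by (metis inv_closed l_one m_assoc r_inv)
  define lt where "lt g h \<longleftrightarrow> inv g \<otimes> h \<in> P" for g h
  have "left_ordering G lt"
    unfolding left_ordering_def
  proof (intro conjI ballI impI)
    show "irreflp_on (carrier G) lt"
      using R by (auto simp: irreflp_on_def lt_def)
    show "transp_on (carrier G) lt"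
    proof (rule transp_onI)
      fix x y z assume xyz: "x \<in> carrier G" "y \<in> carrier G" "z \<in> carrier G" "lt x y" "lt y z"
      then have "(inv x \<otimes> y) \<otimes> (inv y \<otimes> z) \<in> P" using mult[of "inv x \<otimes> y" "inv y \<otimes> z"] by (simp add: lt_def)
      moreover have "(inv x \<otimes> y) \<otimes> (inv y \<otimes> z) = inv x \<otimes> z"
        using xyz canc[of y z] by (simp add: m_assoc)
      ultimately show "lt x z" by (simp add: lt_def)
    qed
    show "totalp_on (carrier G) lt"
    proof (rule totalp_onI)
      fix x y assume xy: "x \<in> carrier G" "y \<in> carrier G" "x \<noteq> y"
      have ne: "inv x \<otimes> y \<noteq> \<one>"
        using xy by (metis inv_closed inv_equality inv_inv)
      have "inv x \<otimes> y \<in> carrier G" using xy by simp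
      with R ne have "inv x \<otimes> y \<in> P \<or> inv x \<otimes> y \<in> m_inv G ` P" by auto
      then show "lt x y \<or> lt y x"
      proof
        assume "inv x \<otimes> y \<in> m_inv G ` P"
        then obtain p where "p \<in> P" "inv x \<otimes> y = inv p" by auto
        then have "inv y \<otimes> x = p"
          using xy sub by (metis inv_closed inv_inv inv_mult_group subsetD)
        with \<open>p \<in> P\<close> show ?thesis by (simp add: lt_def)
      qed (simp add: lt_def)
    qed
    fix f g h assume fgh: "f \<in> carrier G" "g \<in> carrier G" "h \<in> carrier G" "lt g h"
    have "inv (f \<otimes> g) \<otimes> (f \<otimes> h) = inv g \<otimes> h"
      using fgh canc[of "inv f" h] by (simp add: inv_mult_group m_assoc)
    then show "lt (f \<otimes> g) (f \<otimes> h)" using fgh by (simp add: lt_def)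
  qed
  moreover have "P = positive_cone G lt"
    using sub by (auto simp: positive_cone_def lt_def)
  ultimately show "P \<in> LO G" by (auto simp: LO_def)
qed

definition finite_index_subgroup :: "'a set \<Rightarrow> ('a, 'b) monoid_scheme \<Rightarrow> bool" where
  "finite_index_subgroup H G \<longleftrightarrow> subgroup H G \<and> finite (rcosets\<^bsub>G\<^esub> H)"

definition virtually_abelian :: "('a, 'b) monoid_scheme \<Rightarrow> bool" where
  "virtually_abelian G \<longleftrightarrow>
     (\<exists>H. finite_index_subgroup H G \<and> comm_group (G\<lparr>carrier := H\<rparr>))"

text \<open>A commensuration is a triple of domain, codomain and underlying function. The function is
  unconstrained outside the domain; these values disappear on passing to equivalence classes.\<close>

type_synonym 'a commensuration = "'a set \<times> 'a set \<times> ('a \<Rightarrow> 'a)"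

definition commensurations :: "('a, 'b) monoid_scheme \<Rightarrow> 'a commensuration set" where
  "commensurations G = {(H1, H2, \<phi>). finite_index_subgroup H1 G \<and> finite_index_subgroup H2 G \<and>
     \<phi> \<in> iso (G\<lparr>carrier := H1\<rparr>) (G\<lparr>carrier := H2\<rparr>)}"

definition comm_rel :: "('a, 'b) monoid_scheme \<Rightarrow> 'a commensuration rel" where
  "comm_rel G = {((H1, H2, \<phi>), (H1', H2', \<phi>')).
     (H1, H2, \<phi>) \<in> commensurations G \<and> (H1', H2', \<phi>') \<in> commensurations G \<and>
     (\<exists>H. finite_index_subgroup H G \<and> H \<subseteq> H1 \<inter> H1' \<and> (\<forall>x\<in>H. \<phi> x = \<phi>' x))}"

definition comm_class :: "('a, 'b) monoid_scheme \<Rightarrow> 'a commensuration \<Rightarrow> 'a commensuration set" where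
  "comm_class G c = comm_rel G `` {c}"

fun comm_comp :: "'a commensuration \<Rightarrow> 'a commensuration \<Rightarrow> 'a commensuration" where
  "comm_comp (K1, K2, \<psi>) (H1, H2, \<phi>) = ({x \<in> H1. \<phi> x \<in> K1}, \<psi> ` (H2 \<inter> K1), \<psi> \<circ> \<phi>)"

text \<open>Operations on quotients are unions over representatives; the family involved is constant,
  so the union is the common value.\<close>

definition Comm :: "('a, 'b) monoid_scheme \<Rightarrow> 'a commensuration set monoid" where
  "Comm G = \<lparr>carrier = commensurations G // comm_rel G,
     monoid.mult = (\<lambda>C D. \<Union>c\<in>C. \<Union>d\<in>D. comm_class G (comm_comp c d)),
     one = comm_class G (carrier G, carrier G, id)\<rparr>"

definition virtual_cones :: "('a, 'b) monoid_scheme \<Rightarrow> ('a set \<times> 'a set) set" where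
  "virtual_cones G = {(H, P). finite_index_subgroup H G \<and> P \<in> LO (G\<lparr>carrier := H\<rparr>)}"

definition vlo_rel :: "('a, 'b) monoid_scheme \<Rightarrow> ('a set \<times> 'a set) rel" where
  "vlo_rel G = {((H, P), (H', P')).
     (H, P) \<in> virtual_cones G \<and> (H', P') \<in> virtual_cones G \<and>
     (\<exists>K. finite_index_subgroup K G \<and> K \<subseteq> H \<inter> H' \<and> P \<inter> K = P' \<inter> K)}"

definition vlo_class :: "('a, 'b) monoid_scheme \<Rightarrow> 'a set \<times> 'a set \<Rightarrow> ('a set \<times> 'a set) set" where
  "vlo_class G v = vlo_rel G `` {v}"

definition VLO :: "('a, 'b) monoid_scheme \<Rightarrow> ('a set \<times> 'a set) set set" where
  "VLO G = virtual_cones G // vlo_rel G"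

text \<open>The cone \<open>\<phi> (P \<inter> H1)\<close> lives on the finite index subgroup \<open>\<phi> (H \<inter> H1)\<close>. The action is
  restricted to \<open>VLO G\<close> because the library's permutation group consists of extensional maps.\<close>

definition comm_act ::
  "('a, 'b) monoid_scheme \<Rightarrow> 'a commensuration set \<Rightarrow>
     ('a set \<times> 'a set) set \<Rightarrow> ('a set \<times> 'a set) set" where
  "comm_act G C = (\<lambda>V\<in>VLO G.
     \<Union>(H1, H2, \<phi>)\<in>C. \<Union>(H, P)\<in>V. vlo_class G (\<phi> ` (H \<inter> H1), \<phi> ` (P \<inter> H1)))"

definition is_tau ::
  "('a, 'b) monoid_scheme \<Rightarrow> nat \<Rightarrow> nat \<Rightarrow> 'a set \<Rightarrow> 'a set \<Rightarrow> ('a \<Rightarrow> 'a) \<Rightarrow> bool" where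
  "is_tau G p q H1 H2 \<phi> \<longleftrightarrow> \<phi> \<in> iso (G\<lparr>carrier := H1\<rparr>) (G\<lparr>carrier := H2\<rparr>) \<and>
     (\<forall>g\<in>H1. \<phi> (g [^]\<^bsub>G\<^esub> q) = g [^]\<^bsub>G\<^esub> p)"

end

theory Submission
  imports Defs
begin

text \<open>
  A commensuration \<open>\<phi>\<close> acts trivially on virtual left-orderings exactly when, for every left-ordering
  of a finite index subgroup, \<open>\<phi>\<close> preserves the positive cone on some smaller finite index subgroup.
  Since every element has a power in any given finite index subgroup, and since an element and its
  positive powers have the same sign, such a \<open>\<phi>\<close> never changes a sign: \<open>g\<close> and \<open>\<phi> g\<close> have the same
  sign in every left-ordering of \<open>G\<close>.

  The heart of the proof is that left-orderings of a bi-orderable group separate elements as well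
  as they possibly can (\<open>cone_separates\<close>): for nontrivial \<open>g\<close> and \<open>h\<close>, unless \<open>h\<^sup>q = g\<^sup>p\<close> for some
  positive \<open>p, q\<close>, some left-ordering makes \<open>g\<close> positive and \<open>h\<close> negative. Let \<open>A\<close> be the centralizer of the centralizer
  of \<open>g\<close>, an abelian group containing \<open>g\<close>. Conjugation preserves a bi-ordering, so comparing how two
  elements move the members of the centralizer of \<open>g\<close> under conjugation orders the cosets of \<open>A\<close>
  invariantly; hence every ordering of \<open>A\<close> extends to \<open>G\<close> lexicographically
  (\<open>centralizer_relatively_convex\<close>). If \<open>h\<close> lies outside \<open>A\<close>, the sign of \<open>g\<close> can be chosen without
  affecting that of \<open>h\<close>; if \<open>h\<close> lies in \<open>A\<close>, the question is about torsion-free abelian groups, where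
  every subsemigroup avoiding the identity lies in a positive cone.

  So an element of the kernel satisfies \<open>\<phi>(g)\<^sup>q = g\<^sup>p\<close> for all \<open>g\<close>, with a ratio \<open>p/q > 0\<close> depending
  on \<open>g\<close>. Roots are unique in a bi-orderable group, so the ratio of a nontrivial element is well
  defined. Commuting nontrivial elements have the same ratio (\<open>proportional_commuting\<close>), which settles
  the abelian case, as a virtually abelian bi-orderable group is abelian. Elements whose ratio is
  not 1 are central in the domain of \<open>\<phi>\<close> (\<open>proportional_scaled_central\<close>). If the domain of \<open>\<phi>\<close> contains non-commuting
  \<open>a, b\<close>, then a central \<open>y\<close> of ratio other than 1 would pass its ratio on to \<open>a\<close>, making \<open>a\<close> central; so
  all ratios are 1 and \<open>\<phi>\<close> is the identity. Conversely \<open>\<tau>\<^bsub>p/q\<^esub>\<close> preserves signs, as \<open>\<phi>(g)\<^sup>q = g\<^sup>p\<close>.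
\<close>

section \<open>Conjugation, centralizers and positive cones\<close>

context group
begin

definition conjugate :: "'a \<Rightarrow> 'a \<Rightarrow> 'a" where
  "conjugate x y = x \<otimes> y \<otimes> inv x"

lemma cancel_inv_left:
  assumes "x \<in> carrier G" "y \<in> carrier G"
  shows "inv x \<otimes> (x \<otimes> y) = y" "x \<otimes> (inv x \<otimes> y) = y"
  using assms by (simp_all flip: m_assoc)

lemma conjugate_closed [simp]: "x \<in> carrier G \<Longrightarrow> y \<in> carrier G \<Longrightarrow> conjugate x y \<in> carrier G"
  by (simp add: conjugate_def)

lemma conjugate_conjugate:
  assumes "x \<in> carrier G" "x' \<in> carrier G" "y \<in> carrier G"
  shows "conjugate x (conjugate x' y) = conjugate (x \<otimes> x') y"
  using assms by (simp add: conjugate_def inv_mult_group m_assoc)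

lemma conjugate_one [simp]: "y \<in> carrier G \<Longrightarrow> conjugate \<one> y = y"
  by (simp add: conjugate_def)

lemma conjugate_mult:
  assumes "x \<in> carrier G" "y \<in> carrier G" "z \<in> carrier G"
  shows "conjugate x (y \<otimes> z) = conjugate x y \<otimes> conjugate x z"
  using assms by (simp add: conjugate_def m_assoc cancel_inv_left)

lemma conjugate_eq_iff:
  assumes "x \<in> carrier G" "y \<in> carrier G"
  shows "conjugate x y = y \<longleftrightarrow> x \<otimes> y = y \<otimes> x"
  using assms by (simp add: conjugate_def inv_solve_right')

lemma conjugate_int_pow:
  assumes "x \<in> carrier G" "y \<in> carrier G"
  shows "conjugate x y [^] (k::int) = conjugate x (y [^] k)"
proof -
  have "conjugate x \<in> hom G G" using assms by (auto simp: hom_def conjugate_mult)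
  then interpret group_hom G G "conjugate x" by unfold_locales
  show ?thesis using assms by (simp add: hom_int_pow)
qed

lemma commute_int_pow:
  assumes "x \<in> carrier G" "y \<in> carrier G" "x \<otimes> y = y \<otimes> x"
  shows "x [^] (k::int) \<otimes> y = y \<otimes> x [^] k"
proof -
  have "conjugate y x = x" using assms by (subst conjugate_eq_iff) auto
  then have "conjugate y (x [^] k) = x [^] k"
    using conjugate_int_pow[OF assms(2,1), of k] by simp
  then show ?thesis using assms conjugate_eq_iff[of y "x [^] k"] by (metis int_pow_closed)
qed

definition centralizer :: "'a set \<Rightarrow> 'a set" where
  "centralizer Y = {x \<in> carrier G. \<forall>y\<in>Y. conjugate x y = y}"

lemma conjugate_inv_eq:
  assumes "x \<in> carrier G" "y \<in> carrier G" "conjugate x y = y"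
  shows "conjugate (inv x) y = y"
proof -
  have "conjugate (inv x) (conjugate x y) = y" using assms(1,2) by (simp add: conjugate_conjugate)
  then show ?thesis using assms(3) by simp
qed

lemma centralizer_subgroup:
  assumes "Y \<subseteq> carrier G"
  shows "subgroup (centralizer Y) G"
proof (rule subgroupI)
  show "centralizer Y \<noteq> {}" using assms by (auto simp: centralizer_def intro!: exI[of _ \<one>])
  show "inv x \<in> centralizer Y" if "x \<in> centralizer Y" for x
    using assms that conjugate_inv_eq by (auto simp: centralizer_def)
  show "x \<otimes> x' \<in> centralizer Y" if "x \<in> centralizer Y" "x' \<in> centralizer Y" for x x'
    using assms that by (auto simp: centralizer_def subset_iff simp flip: conjugate_conjugate)
qed (auto simp: centralizer_def)

text \<open>\<open>is_cone H P\<close> says that \<open>P\<close> is the positive cone of a left-ordering of the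
  subgroup \<open>H\<close>. The partition condition is reduced to what has to be checked: together with closure
  under multiplication, omitting \<open>\<one>\<close> already makes \<open>P\<close> and its inverse disjoint.\<close>

definition is_cone :: "'a set \<Rightarrow> 'a set \<Rightarrow> bool" where
  "is_cone H P \<longleftrightarrow> P \<subseteq> H \<and> (\<forall>x\<in>P. \<forall>y\<in>P. x \<otimes> y \<in> P) \<and>
     (\<forall>x\<in>H. x = \<one> \<or> x \<in> P \<or> inv x \<in> P) \<and> \<one> \<notin> P"

lemma
  assumes "is_cone H P"
  shows is_cone_subset: "P \<subseteq> H"
    and is_cone_mult: "x \<in> P \<Longrightarrow> y \<in> P \<Longrightarrow> x \<otimes> y \<in> P"
    and is_cone_total: "x \<in> H \<Longrightarrow> x = \<one> \<or> x \<in> P \<or> inv x \<in> P"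
    and is_cone_one: "\<one> \<notin> P"
  using assms unfolding is_cone_def by blast+

lemma LO_subgroup_iff:
  assumes H: "subgroup H G"
  shows "P \<in> LO (G\<lparr>carrier := H\<rparr>) \<longleftrightarrow> is_cone H P"
proof -
  interpret H: group "G\<lparr>carrier := H\<rparr>" using H by (rule subgroup.subgroup_is_group) (rule is_group)
  have sub: "H \<subseteq> carrier G" using H by (rule subgroup.subset)
  have inv: "m_inv (G\<lparr>carrier := H\<rparr>) x = inv x" if "x \<in> H" for x using H that by simp
  show ?thesis (is "_ = ?R")
  proof
    assume P: "P \<in> LO (G\<lparr>carrier := H\<rparr>)"
    have PH: "P \<subseteq> H" using P by (simp add: H.LO_iff)
    have ii: "m_inv (G\<lparr>carrier := H\<rparr>) ` P = m_inv G ` P" using PH inv by (intro image_cong) auto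
    have eq: "H = P \<union> m_inv G ` P \<union> {\<one>}" using P by (simp add: H.LO_iff ii)
    have "x = \<one> \<or> x \<in> P \<or> inv x \<in> P" if "x \<in> H" for x
    proof -
      have "x \<in> P \<or> x = \<one> \<or> (\<exists>y\<in>P. x = inv y)" using eq that by blast
      moreover have "inv (inv y) = y" if "y \<in> P" for y using that PH sub by auto
      ultimately show ?thesis by auto
    qed
    moreover have "x \<otimes> y \<in> P" if "x \<in> P" "y \<in> P" for x y
      using P that unfolding H.LO_iff set_mult_def by auto
    moreover have "\<one> \<notin> P" using P by (simp add: H.LO_iff)
    ultimately show ?R using PH by (auto simp: is_cone_def)
  next
    assume P: ?R
    then have PH: "P \<subseteq> H" by (simp add: is_cone_def)
    have ii: "m_inv (G\<lparr>carrier := H\<rparr>) ` P = m_inv G ` P" using PH inv by (intro image_cong) auto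
    have nb: "inv y \<notin> P" if "y \<in> P" for y
    proof
      assume "inv y \<in> P"
      then have "y \<otimes> inv y \<in> P" using P that by (auto simp: is_cone_def)
      then show False using P PH that sub by (auto simp: is_cone_def)
    qed
    have "H \<subseteq> P \<union> m_inv G ` P \<union> {\<one>}"
    proof
      fix x assume x: "x \<in> H"
      then have "x = inv (inv x)" using sub by auto
      then show "x \<in> P \<union> m_inv G ` P \<union> {\<one>}" using P x by (auto simp: is_cone_def)
    qed
    moreover have "m_inv G ` P \<subseteq> H" "\<one> \<in> H"
      using PH H by (auto intro: subgroup.m_inv_closed subgroup.one_closed)
    moreover have "\<one> \<noteq> inv y" if "y \<in> P" for y
    proof
      assume "\<one> = inv y"
      then have "inv (inv y) = \<one>" by (metis inv_one)
      then have "y = \<one>" using that PH sub by auto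
      then show False using that P by (simp add: is_cone_def)
    qed
    moreover have "P <#>\<^bsub>G\<lparr>carrier := H\<rparr>\<^esub> P \<subseteq> P" "\<one> \<notin> P"
      using P by (auto simp: is_cone_def set_mult_def)
    moreover have "P \<inter> m_inv G ` P = {}" using nb by blast
    moreover have "\<one> \<notin> m_inv G ` P" using calculation(4) by blast
    ultimately show "P \<in> LO (G\<lparr>carrier := H\<rparr>)"
      using PH unfolding H.LO_iff ii by auto
  qed
qed

lemma is_cone_inverse:
  assumes H: "subgroup H G" and P: "is_cone H P"
  shows "is_cone H {x \<in> H. inv x \<in> P}"
proof -
  have [simp]: "x \<in> carrier G" if "x \<in> H" for x using H that by (rule subgroup.mem_carrier)
  have mult: "inv (x \<otimes> y) \<in> P" if "x \<in> H" "y \<in> H" "inv x \<in> P" "inv y \<in> P" for x y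
    using that is_cone_mult[OF P, of "inv y" "inv x"] by (simp add: inv_mult_group)
  show ?thesis unfolding is_cone_def
  proof (intro conjI ballI)
    show "x \<otimes> y \<in> {x \<in> H. inv x \<in> P}" if "x \<in> {x \<in> H. inv x \<in> P}" "y \<in> {x \<in> H. inv x \<in> P}" for x y
      using that mult subgroup.m_closed[OF H] by simp
    show "x = \<one> \<or> x \<in> {x \<in> H. inv x \<in> P} \<or> inv x \<in> {x \<in> H. inv x \<in> P}" if "x \<in> H" for x
      using that is_cone_total[OF P that] subgroup.m_inv_closed[OF H that] by auto
    show "\<one> \<notin> {x \<in> H. inv x \<in> P}" using is_cone_one[OF P] by simp
  qed simp
qed

end

section \<open>Unique roots in bi-ordered groups\<close>

locale bi_ordered_group = group G for G (structure) +
  fixes lt :: "'a \<Rightarrow> 'a \<Rightarrow> bool" (infix "\<lessdot>" 50)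
  assumes bi: "bi_ordering G (\<lessdot>)"
begin

lemma
  shows irreflp: "irreflp_on (carrier G) (\<lessdot>)" and transp: "transp_on (carrier G) (\<lessdot>)"
    and totalp: "totalp_on (carrier G) (\<lessdot>)"
    and lt_mult_left:
      "x \<lessdot> y \<Longrightarrow> z \<in> carrier G \<Longrightarrow> x \<in> carrier G \<Longrightarrow> y \<in> carrier G \<Longrightarrow> z \<otimes> x \<lessdot> z \<otimes> y"
    and lt_mult_right:
      "x \<lessdot> y \<Longrightarrow> z \<in> carrier G \<Longrightarrow> x \<in> carrier G \<Longrightarrow> y \<in> carrier G \<Longrightarrow> x \<otimes> z \<lessdot> y \<otimes> z"
  using bi by (simp_all add: bi_ordering_def left_ordering_def)

lemma lt_irrefl: "x \<in> carrier G \<Longrightarrow> \<not> x \<lessdot> x"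
  using irreflp by (simp add: irreflp_on_def)

lemma lt_trans:
  "x \<lessdot> y \<Longrightarrow> y \<lessdot> z \<Longrightarrow> x \<in> carrier G \<Longrightarrow> y \<in> carrier G \<Longrightarrow> z \<in> carrier G \<Longrightarrow> x \<lessdot> z"
  using transp by (meson transp_onD)

lemma lt_total: "x \<in> carrier G \<Longrightarrow> y \<in> carrier G \<Longrightarrow> x \<noteq> y \<Longrightarrow> x \<lessdot> y \<or> y \<lessdot> x"
  using totalp by (simp add: totalp_on_def)

lemma lt_conjugate:
  "x \<lessdot> y \<Longrightarrow> z \<in> carrier G \<Longrightarrow> x \<in> carrier G \<Longrightarrow> y \<in> carrier G \<Longrightarrow> conjugate z x \<lessdot> conjugate z y"
  by (simp add: conjugate_def lt_mult_left lt_mult_right)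

text \<open>Multiplying two inequalities uses invariance on both sides, so this is where a
  left-ordering would not be enough. Uniqueness of roots follows because the order is total.\<close>

lemma lt_pow:
  assumes "x \<lessdot> y" "x \<in> carrier G" "y \<in> carrier G"
  shows "x [^] Suc n \<lessdot> y [^] Suc n"
proof (induction n)
  case (Suc n)
  have "x [^] Suc n \<otimes> x \<lessdot> x [^] Suc n \<otimes> y"
    by (rule lt_mult_left) (use assms in auto)
  moreover have "x [^] Suc n \<otimes> y \<lessdot> y [^] Suc n \<otimes> y"
    by (rule lt_mult_right[OF Suc.IH]) (use assms in auto)
  ultimately have "x [^] Suc n \<otimes> x \<lessdot> y [^] Suc n \<otimes> y"
    by (rule lt_trans) (use assms in auto)
  then show ?case by simp
qed (use assms in simp)

lemma nat_root_unique:
  assumes "x [^] (n::nat) = y [^] n" "0 < n" "x \<in> carrier G" "y \<in> carrier G"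
  shows "x = y"
proof (rule ccontr)
  obtain m where n: "n = Suc m" using assms(2) gr0_conv_Suc by blast
  assume "x \<noteq> y"
  then have "x [^] n \<lessdot> y [^] n \<or> y [^] n \<lessdot> x [^] n"
    using lt_total[OF assms(3,4)] lt_pow[OF _ assms(3,4)] lt_pow[OF _ assms(4,3)]
    unfolding n by blast
  then show False using assms lt_irrefl[of "y [^] n"] by simp
qed

lemma int_root_unique:
  assumes "x [^] (k::int) = y [^] k" "k \<noteq> 0" "x \<in> carrier G" "y \<in> carrier G"
  shows "x = y"
proof (cases k rule: int_cases2)
  case (nonneg n)
  then have "x [^] n = y [^] n" using assms(1) by (simp only: int_pow_int)
  then show ?thesis by (rule nat_root_unique) (use nonneg assms in auto)
next
  case (nonpos n)
  then have "inv (x [^] n) = inv (y [^] n)"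
    using assms(1) int_pow_neg_int[OF assms(3), of n] int_pow_neg_int[OF assms(4), of n] by metis
  then have "inv (inv (x [^] n)) = inv (inv (y [^] n))" by (rule arg_cong)
  then have "x [^] n = y [^] n" using assms by simp
  then show ?thesis by (rule nat_root_unique) (use nonpos assms in auto)
qed

lemma torsion_free:
  assumes "x [^] (k::int) = \<one>" "k \<noteq> 0" "x \<in> carrier G"
  shows "x = \<one>"
  by (rule int_root_unique[of x k \<one>]) (use assms in auto)

lemma nat_torsion_free:
  assumes "x [^] (n::nat) = \<one>" "0 < n" "x \<in> carrier G"
  shows "x = \<one>"
  by (rule nat_root_unique[of x n \<one>]) (use assms in auto)

text \<open>Conjugating \<open>x\<close> by \<open>y\<close> gives another root of the same power, which must be
  \<open>x\<close> itself.\<close>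

lemma commute_root:
  assumes "x [^] (k::int) \<otimes> y = y \<otimes> x [^] k" "k \<noteq> 0" "x \<in> carrier G" "y \<in> carrier G"
  shows "x \<otimes> y = y \<otimes> x"
proof -
  have "conjugate y (x [^] k) = x [^] k" using assms by (subst conjugate_eq_iff) auto
  then have "conjugate y x [^] k = x [^] k" using assms by (simp add: conjugate_int_pow)
  then have "conjugate y x = x" by (rule int_root_unique) (use assms in auto)
  then show ?thesis using assms conjugate_eq_iff[of y x] by metis
qed

section \<open>Left-orderings that separate two elements\<close>

text \<open>The group acts on itself by conjugation preserving the bi-ordering. After well-ordering \<open>Y\<close>,
  call \<open>x\<close> positive if the first element of \<open>Y\<close> that \<open>x\<close> moves is moved upwards. This decides the
  sign of every element outside the centralizer of \<open>Y\<close>, and it depends only on the double coset by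
  the centralizer. The set \<open>S\<close> of these positive elements is what is needed to extend orderings of
  the centralizer lexicographically to the whole group.\<close>

lemma centralizer_relatively_convex:
  assumes Y: "Y \<subseteq> carrier G"
  obtains S where "S \<subseteq> carrier G" "S \<inter> centralizer Y = {}"
    "\<And>x y. x \<in> S \<Longrightarrow> y \<in> S \<Longrightarrow> x \<otimes> y \<in> S"
    "\<And>x a. x \<in> S \<Longrightarrow> a \<in> centralizer Y \<Longrightarrow> a \<otimes> x \<in> S \<and> x \<otimes> a \<in> S"
    "\<And>x. x \<in> carrier G \<Longrightarrow> x \<notin> centralizer Y \<Longrightarrow> x \<in> S \<or> inv x \<in> S"
proof -
  obtain r :: "'a rel" where r: "well_order_on UNIV r"
    using well_order_on by (rule exE)
  define R where "R = r - Id"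
  have wf: "wf R" and tot: "total r" and trans: "trans r" and anti: "antisym r"
    using r unfolding R_def order_on_defs by blast+
  have R_tot: "(x, y) \<in> R \<or> (y, x) \<in> R" if "x \<noteq> y" for x y
    using tot that by (simp add: total_on_def R_def)
  have R_trans: "(x, z) \<in> R" if "(x, y) \<in> R" "(y, z) \<in> R" for x y z
    using that transD[OF trans, of x y z] antisymD[OF anti, of x y] by (auto simp: R_def)
  define first where "first x y \<longleftrightarrow> y \<in> Y \<and> (\<forall>y'\<in>Y. (y', y) \<in> R \<longrightarrow> conjugate x y' = y')" for x y
  define S where "S = {x \<in> carrier G. \<exists>y. first x y \<and> y \<lessdot> conjugate x y}"
  show ?thesis
  proof
    show "S \<subseteq> carrier G" by (auto simp: S_def)
    show "S \<inter> centralizer Y = {}"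
      using Y lt_irrefl by (fastforce simp: S_def centralizer_def first_def)
  next
    fix x x' assume "x \<in> S" "x' \<in> S"
    then obtain y y' where y: "first x y" "y \<lessdot> conjugate x y" "x \<in> carrier G"
      and y': "first x' y'" "y' \<lessdot> conjugate x' y'" "x' \<in> carrier G" by (auto simp: S_def)
    have cy: "y \<in> carrier G" "y' \<in> carrier G" using y y' Y by (auto simp: first_def)
    consider "y = y'" | "(y, y') \<in> R" | "(y', y) \<in> R" using R_tot by blast
    then have "\<exists>z. first (x \<otimes> x') z \<and> z \<lessdot> conjugate (x \<otimes> x') z"
    proof cases
      case 1
      have "conjugate x y \<lessdot> conjugate x (conjugate x' y)" using 1 y y' cy by (intro lt_conjugate) auto
      then have "y \<lessdot> conjugate (x \<otimes> x') y"
        using y y' cy lt_trans[of y "conjugate x y"] by (simp add: conjugate_conjugate)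
      moreover have "first (x \<otimes> x') y" using 1 y y' Y
        by (auto simp: first_def subset_iff simp flip: conjugate_conjugate)
      ultimately show ?thesis by blast
    next
      case 2
      then have "conjugate (x \<otimes> x') y = conjugate x y"
        using y y' cy by (auto simp: first_def simp flip: conjugate_conjugate)
      moreover have "first (x \<otimes> x') y" using 2 y y' Y R_trans
        by (auto simp: first_def subset_iff simp flip: conjugate_conjugate)
      ultimately show ?thesis using y by auto
    next
      case 3
      then have "conjugate x y' = y'" using y y' by (auto simp: first_def)
      then have "y' \<lessdot> conjugate (x \<otimes> x') y'"
        using lt_conjugate[of y' "conjugate x' y'" x] y y' cy by (simp add: conjugate_conjugate)
      moreover have "first (x \<otimes> x') y'" using 3 y y' Y R_trans
        by (auto simp: first_def subset_iff simp flip: conjugate_conjugate)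
      ultimately show ?thesis by blast
    qed
    then show "x \<otimes> x' \<in> S" using y y' by (simp add: S_def)
  next
    fix x a assume x: "x \<in> S" and "a \<in> centralizer Y"
    then have a: "a \<in> carrier G" "\<And>y. y \<in> Y \<Longrightarrow> conjugate a y = y" by (auto simp: centralizer_def)
    from x obtain y where y: "first x y" "y \<lessdot> conjugate x y" "x \<in> carrier G" by (auto simp: S_def)
    have cy: "y \<in> Y" "y \<in> carrier G" using y Y by (auto simp: first_def)
    have "first (a \<otimes> x) y" "first (x \<otimes> a) y"
      using y a Y by (auto simp: first_def subset_iff simp flip: conjugate_conjugate)
    moreover have "y \<lessdot> conjugate (a \<otimes> x) y" using lt_conjugate[of y "conjugate x y" a] a y cy by (simp add: conjugate_conjugate)
    moreover have "y \<lessdot> conjugate (x \<otimes> a) y" using a y cy by (simp flip: conjugate_conjugate)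
    ultimately show "a \<otimes> x \<in> S \<and> x \<otimes> a \<in> S" using a y by (auto simp: S_def)
  next
    fix x assume x: "x \<in> carrier G" "x \<notin> centralizer Y"
    then have "{y \<in> Y. conjugate x y \<noteq> y} \<noteq> {}" by (auto simp: centralizer_def)
    then obtain y where y: "y \<in> {y \<in> Y. conjugate x y \<noteq> y}"
      "\<And>y'. (y', y) \<in> R \<Longrightarrow> y' \<notin> {y \<in> Y. conjugate x y \<noteq> y}"
      using wfE_min[OF wf] by (metis (no_types, lifting) ex_in_conv)
    have cy: "y \<in> carrier G" using y Y by auto
    have f: "first x y" using y by (auto simp: first_def)
    then have f': "first (inv x) y" using x Y conjugate_inv_eq by (auto simp: first_def)
    have "y \<lessdot> conjugate x y \<or> conjugate x y \<lessdot> y" using y x cy lt_total[of y "conjugate x y"] by auto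
    then show "x \<in> S \<or> inv x \<in> S"
    proof
      assume "conjugate x y \<lessdot> y"
      then have "conjugate (inv x) (conjugate x y) \<lessdot> conjugate (inv x) y" using x cy by (intro lt_conjugate) auto
      then have "y \<lessdot> conjugate (inv x) y" using x cy by (simp add: conjugate_conjugate)
      then show ?thesis using f' x by (auto simp: S_def)
    qed (use f x in \<open>auto simp: S_def\<close>)
  qed
qed

text \<open>A maximal subsemigroup \<open>M\<close> that avoids \<open>\<one>\<close>, given by Zorn's lemma, is a cone.
  If \<open>x \<noteq> \<one>\<close> is not in \<open>M\<close>, then by maximality \<open>M\<close> and \<open>x\<close> together generate \<open>\<one>\<close>, which puts a positive
  power of \<open>inv x\<close> into \<open>M\<close>. Were \<open>inv x\<close> missing from \<open>M\<close> as well, then a positive power of \<open>x\<close> would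
  also lie in \<open>M\<close>, and suitable powers of the two would multiply to \<open>\<one>\<close>.\<close>

lemma abelian_cone_extends_semigroup:
  assumes A: "subgroup A G" and comm: "\<And>x y. x \<in> A \<Longrightarrow> y \<in> A \<Longrightarrow> x \<otimes> y = y \<otimes> x"
    and T: "T \<subseteq> A" "\<And>x y. x \<in> T \<Longrightarrow> y \<in> T \<Longrightarrow> x \<otimes> y \<in> T" "\<one> \<notin> T"
  obtains Q where "is_cone A Q" "T \<subseteq> Q"
proof -
  have [simp]: "x \<in> carrier G" if "x \<in> A" for x using A that by (rule subgroup.mem_carrier)
  have [simp]: "\<one> \<in> A" using A by (rule subgroup.one_closed)
  have [simp]: "x \<otimes> y \<in> A" if "x \<in> A" "y \<in> A" for x y using A that by (rule subgroup.m_closed)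
  have pow [simp]: "x [^] (n::nat) \<in> A" if "x \<in> A" for x n using that by (induction n) auto
  define F where "F = {M. T \<subseteq> M \<and> M \<subseteq> A \<and> \<one> \<notin> M \<and> (\<forall>x\<in>M. \<forall>y\<in>M. x \<otimes> y \<in> M)}"
  have "\<exists>M\<in>F. (\<forall>N\<in>F. M \<subseteq> N \<longrightarrow> N = M)"
  proof (rule subset_Zorn_nonempty)
    show "F \<noteq> {}" using T by (auto simp: F_def)
    fix C assume ne: "C \<noteq> {}" and C: "subset.chain F C"
    have CF: "\<And>M. M \<in> C \<Longrightarrow> M \<in> F" and
      lin: "\<And>M N. M \<in> C \<Longrightarrow> N \<in> C \<Longrightarrow> M \<subseteq> N \<or> N \<subseteq> M"
      using C by (auto simp: subset_chain_def)
    have "x \<otimes> y \<in> \<Union>C" if xy: "x \<in> \<Union>C" "y \<in> \<Union>C" for x y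
    proof -
      obtain M N where "M \<in> C" "N \<in> C" "x \<in> M" "y \<in> N" using xy by blast
      with lin obtain L where "L \<in> C" "x \<in> L" "y \<in> L" by blast
      then show ?thesis using CF[of L] unfolding F_def by blast
    qed
    moreover have "T \<subseteq> \<Union>C" "\<Union>C \<subseteq> A" "\<one> \<notin> \<Union>C" using ne CF unfolding F_def by blast+
    ultimately show "\<Union>C \<in> F" unfolding F_def by blast
  qed
  then obtain M where M: "M \<in> F" and max: "\<And>N. N \<in> F \<Longrightarrow> M \<subseteq> N \<Longrightarrow> N = M" by blast
  have MA: "M \<subseteq> A" and M1: "\<one> \<notin> M" and Mm: "\<And>x y. x \<in> M \<Longrightarrow> y \<in> M \<Longrightarrow> x \<otimes> y \<in> M"
    and TM: "T \<subseteq> M" using M by (auto simp: F_def)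
  have Mpow: "x [^] n \<in> M" if "x \<in> M" "0 < n" for x and n :: nat
    using that(2)
  proof (induction n)
    case (Suc n)
    then show ?case using that(1) Mm MA by (cases n) auto
  qed simp
  have key: "\<exists>k>0. inv x [^] (k::nat) \<in> M" if x: "x \<in> A" "x \<noteq> \<one>" "x \<notin> M" for x
  proof -
    \<comment> \<open>the subsemigroup generated by \<open>M\<close> and \<open>x\<close>\<close>
    define M' where "M' = {m \<otimes> x [^] (k::nat) |m k. m \<in> insert \<one> M \<and> (m \<in> M \<or> 0 < k)}"
    have sub: "M \<subseteq> M'"
    proof
      fix m assume "m \<in> M"
      then show "m \<in> M'" using MA unfolding M'_def by (intro CollectI exI[of _ m] exI[of _ 0]) auto
    qed
    have "x \<in> M'" using x unfolding M'_def by (intro CollectI exI[of _ \<one>] exI[of _ 1]) auto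
    have mult: "y \<otimes> z \<in> M'" if yz: "y \<in> M'" "z \<in> M'" for y z
    proof -
      obtain m k where y: "y = m \<otimes> x [^] (k::nat)" "m \<in> insert \<one> M" "m \<in> M \<or> 0 < k"
        using yz(1) unfolding M'_def by blast
      obtain m' k' where z: "z = m' \<otimes> x [^] (k'::nat)" "m' \<in> insert \<one> M" "m' \<in> M \<or> 0 < k'"
        using yz(2) unfolding M'_def by blast
      have mA: "m \<in> A" "m' \<in> A" using y z MA by auto
      have "y \<otimes> z = m \<otimes> (x [^] k \<otimes> m') \<otimes> x [^] k'"
        using y z mA x by (simp add: m_assoc)
      also have "x [^] k \<otimes> m' = m' \<otimes> x [^] k" using mA x by (intro comm) auto
      also have "m \<otimes> (m' \<otimes> x [^] k) \<otimes> x [^] k' = (m \<otimes> m') \<otimes> x [^] (k + k')"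
        using mA x by (simp add: m_assoc nat_pow_mult)
      finally show ?thesis using y z mA Mm unfolding M'_def
        by (intro CollectI exI[of _ "m \<otimes> m'"] exI[of _ "k + k'"]) auto
    qed
    have "M' \<subseteq> A" using MA x by (auto simp: M'_def)
    have "M' \<notin> F" using max[of M'] sub \<open>x \<in> M'\<close> x by blast
    then have "\<one> \<in> M'" using sub TM mult \<open>M' \<subseteq> A\<close> by (auto simp: F_def)
    then obtain m k where mk: "\<one> = m \<otimes> x [^] (k::nat)" "m \<in> insert \<one> M" "m \<in> M \<or> 0 < k"
      unfolding M'_def by blast
    have mA: "m \<in> carrier G" using mk MA by auto
    have k: "0 < k" using mk M1 mA by (cases "k = 0") auto
    then have "m \<noteq> \<one>" using mk nat_torsion_free[of x k] x by auto
    then have "m \<in> M" using mk by auto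
    moreover have "m = inv (x [^] k)" using mk(1) mA x by (intro inv_equality[symmetric]) auto
    ultimately show ?thesis using k x by (auto simp: nat_pow_inv)
  qed
  have "x = \<one> \<or> x \<in> M \<or> inv x \<in> M" if x: "x \<in> A" for x
  proof (rule ccontr)
    assume neg: "\<not> ?thesis"
    have ix: "inv x \<in> A" using A x by (rule subgroup.m_inv_closed)
    obtain k where k: "0 < k" "inv x [^] (k::nat) \<in> M" using key x neg by blast
    have "inv x \<noteq> \<one>" using neg x by simp
    then obtain j where j: "0 < j" "x [^] (j::nat) \<in> M" using key[of "inv x"] ix neg x by auto
    have "(x [^] j) [^] k \<otimes> (inv x [^] k) [^] j \<in> M" using j k Mm Mpow by blast
    moreover have "(x [^] j) [^] k \<otimes> (inv x [^] k) [^] j = \<one>"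
      using x by (simp add: nat_pow_pow nat_pow_inv mult.commute)
    ultimately show False using M1 by simp
  qed
  then have "is_cone A M" using MA M1 Mm by (auto simp: is_cone_def)
  then show ?thesis using TM that by blast
qed

text \<open>The independence assumption says precisely that the semigroup generated by \<open>g\<close>
  and \<open>inv h\<close> avoids \<open>\<one>\<close>.\<close>

lemma abelian_cone_separates:
  assumes A: "subgroup A G" and comm: "\<And>x y. x \<in> A \<Longrightarrow> y \<in> A \<Longrightarrow> x \<otimes> y = y \<otimes> x"
    and g: "g \<in> A" "g \<noteq> \<one>" and h: "h \<in> A" "h \<noteq> \<one>"
    and indep: "\<And>(p::nat) (q::nat). 0 < p \<Longrightarrow> 0 < q \<Longrightarrow> h [^] q \<noteq> g [^] p"
  obtains Q where "is_cone A Q" "g \<in> Q" "inv h \<in> Q"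
proof -
  have [simp]: "x \<in> carrier G" if "x \<in> A" for x using A that by (rule subgroup.mem_carrier)
  have [simp]: "x \<otimes> y \<in> A" if "x \<in> A" "y \<in> A" for x y using A that by (rule subgroup.m_closed)
  have pow [simp]: "x [^] (n::nat) \<in> A" if "x \<in> A" for x n
    using that subgroup.one_closed[OF A] by (induction n) auto
  \<comment> \<open>\<open>x\<close> is the product of \<open>a\<close> copies of \<open>g\<close> and \<open>b\<close> copies of \<open>inv h\<close>, not both zero\<close>
  define T where "T = {x \<in> A. \<exists>(a::nat) (b::nat). (0 < a \<or> 0 < b) \<and> x \<otimes> h [^] b = g [^] a}"
  have mult: "x \<otimes> y \<in> T" if xy: "x \<in> T" "y \<in> T" for x y
  proof -
    have x: "x \<in> A \<and> (\<exists>(a::nat) (b::nat). (0 < a \<or> 0 < b) \<and> x \<otimes> h [^] b = g [^] a)"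
      using xy(1) unfolding T_def mem_Collect_eq .
    from x obtain a b :: nat where ab: "0 < a \<or> 0 < b" "x \<otimes> h [^] b = g [^] a" by metis
    have y: "y \<in> A \<and> (\<exists>(a::nat) (b::nat). (0 < a \<or> 0 < b) \<and> y \<otimes> h [^] b = g [^] a)"
      using xy(2) unfolding T_def mem_Collect_eq .
    from y obtain a' b' :: nat where ab': "0 < a' \<or> 0 < b'" "y \<otimes> h [^] b' = g [^] a'" by metis
    have "x \<otimes> y \<otimes> h [^] (b + b') = x \<otimes> (y \<otimes> h [^] b) \<otimes> h [^] b'"
      using x y h by (simp add: m_assoc nat_pow_mult)
    also have "y \<otimes> h [^] b = h [^] b \<otimes> y" using y h by (intro comm) auto
    also have "x \<otimes> (h [^] b \<otimes> y) \<otimes> h [^] b' = (x \<otimes> h [^] b) \<otimes> (y \<otimes> h [^] b')"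
      using x y h by (simp add: m_assoc)
    also have "\<dots> = g [^] (a + a')" unfolding ab ab' using g by (simp add: nat_pow_mult)
    finally have "x \<otimes> y \<otimes> h [^] (b + b') = g [^] (a + a')" .
    moreover have "0 < a + a' \<or> 0 < b + b'" using ab(1) by auto
    moreover have "x \<otimes> y \<in> A" using x y by simp
    ultimately show ?thesis unfolding T_def mem_Collect_eq by (metis (no_types))
  qed
  have "\<one> \<notin> T"
  proof
    assume "\<one> \<in> T"
    then obtain a b where ab: "0 < a \<or> 0 < b" "h [^] (b::nat) = g [^] (a::nat)"
      using h by (auto simp: T_def)
    then show False
      using indep[of a b] nat_torsion_free[of g a] nat_torsion_free[of h b] g h
      by (cases "a = 0"; cases "b = 0") auto
  qed
  then obtain Q where Q: "is_cone A Q" "T \<subseteq> Q"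
    using abelian_cone_extends_semigroup[OF A comm, of T] mult by (auto simp: T_def)
  have "g \<in> T" using g h unfolding T_def by (intro CollectI conjI exI[of _ 1] exI[of _ 0]) auto
  moreover have "inv h \<in> T" using h subgroup.m_inv_closed[OF A]
    unfolding T_def by (intro CollectI conjI exI[of _ 0] exI[of _ 1]) auto
  ultimately show ?thesis using Q that by blast
qed

text \<open>The centralizer \<open>A\<close> of the centralizer \<open>Y\<close> of \<open>g\<close> is abelian and contains \<open>g\<close>;
  being a centralizer, it is relatively convex, so orderings of \<open>A\<close> extend to the whole group. If
  \<open>h\<close> is in \<open>A\<close>, the problem is one about \<open>A\<close>; otherwise the signs of \<open>g\<close> and \<open>h\<close> are independent.\<close>

lemma cone_separates:
  assumes g: "g \<in> carrier G" "g \<noteq> \<one>" and h: "h \<in> carrier G" "h \<noteq> \<one>"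
    and indep: "\<And>(p::nat) (q::nat). 0 < p \<Longrightarrow> 0 < q \<Longrightarrow> h [^] q \<noteq> g [^] p"
  obtains P where "is_cone (carrier G) P" "g \<in> P" "inv h \<in> P"
proof -
  define Y where "Y = centralizer {g}"
  define A where "A = centralizer Y"
  have Y: "Y \<subseteq> carrier G" by (auto simp: Y_def centralizer_def)
  have A: "subgroup A G" unfolding A_def by (rule centralizer_subgroup[OF Y])
  have AG: "A \<subseteq> carrier G" using A by (rule subgroup.subset)
  have gY: "g \<in> Y" using g by (simp add: Y_def centralizer_def conjugate_eq_iff)
  have AY: "A \<subseteq> Y" using gY by (auto simp: A_def centralizer_def Y_def)
  have comm: "x \<otimes> y = y \<otimes> x" if "x \<in> A" "y \<in> A" for x y
  proof -
    have "conjugate x y = y" using that AY by (auto simp: A_def centralizer_def)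
    then show ?thesis using that AG conjugate_eq_iff[of x y] by (metis subsetD)
  qed
  have gA: "g \<in> A"
  proof -
    have "conjugate g y = y" if "y \<in> Y" for y
    proof -
      have "conjugate y g = g" "y \<in> carrier G" using that by (auto simp: Y_def centralizer_def)
      then show ?thesis using g conjugate_eq_iff[of y g] conjugate_eq_iff[of g y] by metis
    qed
    then show ?thesis using g by (simp add: A_def centralizer_def)
  qed
  obtain S where S: "S \<subseteq> carrier G" "S \<inter> A = {}"
    "\<And>x y. x \<in> S \<Longrightarrow> y \<in> S \<Longrightarrow> x \<otimes> y \<in> S"
    "\<And>x a. x \<in> S \<Longrightarrow> a \<in> A \<Longrightarrow> a \<otimes> x \<in> S \<and> x \<otimes> a \<in> S"
    "\<And>x. x \<in> carrier G \<Longrightarrow> x \<notin> A \<Longrightarrow> x \<in> S \<or> inv x \<in> S"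
    using centralizer_relatively_convex[OF Y] unfolding A_def by metis
  \<comment> \<open>lexicographic extension of an ordering of \<open>A\<close>\<close>
  have lex: "is_cone (carrier G) (S \<union> Q)" if Q: "is_cone A Q" for Q
    unfolding is_cone_def
  proof (intro conjI ballI)
    show "S \<union> Q \<subseteq> carrier G" using S Q AG by (auto simp: is_cone_def)
    show "\<one> \<notin> S \<union> Q" using S(2) Q subgroup.one_closed[OF A] by (auto simp: is_cone_def)
    show "x \<otimes> y \<in> S \<union> Q" if "x \<in> S \<union> Q" "y \<in> S \<union> Q" for x y
    proof -
      have "Q \<subseteq> A" using Q by (simp add: is_cone_def)
      then show ?thesis using that S(3,4) Q by (auto simp: is_cone_def)
    qed
    show "x = \<one> \<or> x \<in> S \<union> Q \<or> inv x \<in> S \<union> Q" if "x \<in> carrier G" for x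
      using that S(5)[of x] is_cone_total[OF Q, of x] by blast
  qed
  show ?thesis
  proof (cases "h \<in> A")
    case True
    obtain Q where "is_cone A Q" "g \<in> Q" "inv h \<in> Q"
      using abelian_cone_separates[OF A comm gA g(2) True h(2) indep] by blast
    then show ?thesis using that[OF lex] by blast
  next
    case False
    \<comment> \<open>Here \<open>g\<close> and \<open>h\<close> get their signs from \<open>Q\<close> and \<open>S\<close> independently. A cone \<open>Q\<close> of \<open>A\<close> in which
      \<open>g\<close> is positive comes from separating \<open>g\<close> from its own inverse.\<close>
    have sq: "g [^] p \<noteq> g [^] - int q" if "0 < p" "0 < q" for p q :: nat
    proof
      assume "g [^] p = g [^] - int q"
      then have "g [^] int p \<otimes> g [^] int q = \<one>" using g by (simp add: int_pow_neg int_pow_int)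
      then have "g [^] (int p + int q) = \<one>" using g by (simp add: int_pow_mult)
      then show False using torsion_free[of g "int p + int q"] g that by simp
    qed
    obtain Q where Q: "is_cone A Q" "g \<in> Q"
    proof (rule abelian_cone_separates[OF A comm gA g(2), of "inv g"])
      show "inv g \<in> A" using A gA by (rule subgroup.m_inv_closed)
      show "inv g \<noteq> \<one>" using g by simp
      show "inv g [^] q \<noteq> g [^] p" if "0 < p" "0 < q" for p q :: nat
        using sq[OF that] g by (simp add: nat_pow_inv int_pow_neg int_pow_int)
    qed auto
    show ?thesis
    proof (cases "inv h \<in> S")
      case True
      then show ?thesis using that[OF lex] Q by blast
    next
      case hS: False
      then have "h \<in> S" using S(5) h False by blast
      \<comment> \<open>\<open>S\<close> makes \<open>h\<close> positive: make \<open>g\<close> negative by reversing \<open>Q\<close>, then reverse everything\<close>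
      have P: "is_cone (carrier G) {x \<in> carrier G. inv x \<in> S \<union> {x \<in> A. inv x \<in> Q}}"
        using is_cone_inverse[OF subgroup_self lex[OF is_cone_inverse[OF A Q(1)]]] .
      then show ?thesis
        using that[OF P] g h \<open>h \<in> S\<close> Q(2) gA subgroup.m_inv_closed[OF A gA] by auto
    qed
  qed
qed

end

section \<open>Finite index subgroups and commensurations\<close>

text \<open>Operations on equivalence classes are unions of constant families; this evaluates
  them on representatives.\<close>

lemma UN_UN_constant:
  assumes "a \<in> A" "b \<in> B" "\<And>a' b'. a' \<in> A \<Longrightarrow> b' \<in> B \<Longrightarrow> f a' b' = K"
  shows "(\<Union>a'\<in>A. \<Union>b'\<in>B. f a' b') = K"
  using assms by blast

context group
begin

abbreviation fi :: "'a set \<Rightarrow> bool" where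
  "fi H \<equiv> finite_index_subgroup H G"

lemma fi_subgroup: "fi H \<Longrightarrow> subgroup H G"
  by (simp add: finite_index_subgroup_def)

lemma fi_subset: "fi H \<Longrightarrow> H \<subseteq> carrier G"
  by (simp add: fi_subgroup subgroup.subset)

text \<open>Finite index in the form of a finite set of coset representatives, which is easy to
  push forward along isomorphisms and to multiply along a tower of subgroups.\<close>

lemma fi_iff_transversal:
  "fi K \<longleftrightarrow> subgroup K G \<and>
     (\<exists>F. finite F \<and> F \<subseteq> carrier G \<and> (\<forall>g\<in>carrier G. \<exists>k\<in>K. \<exists>f\<in>F. g = k \<otimes> f))"
proof
  assume fi: "fi K"
  then have K: "subgroup K G" by (rule fi_subgroup)
  define rep where "rep C = (SOME g. g \<in> carrier G \<and> C = K #> g)" for C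
  have rep: "rep C \<in> carrier G \<and> C = K #> rep C" if "C \<in> rcosets K" for C
  proof -
    have "\<exists>g. g \<in> carrier G \<and> C = K #> g" using that by (auto simp: RCOSETS_def)
    then show ?thesis unfolding rep_def by (rule someI_ex)
  qed
  have "\<exists>k\<in>K. \<exists>f\<in>rep ` (rcosets K). g = k \<otimes> f" if g: "g \<in> carrier G" for g
  proof -
    have C: "K #> g \<in> rcosets K" using g by (auto simp: RCOSETS_def)
    have "g \<in> K #> g" using g K by (rule rcos_self)
    then have "g \<in> K #> rep (K #> g)" using rep[OF C] by simp
    then show ?thesis using C unfolding r_coset_def by blast
  qed
  moreover have "finite (rep ` (rcosets K))" using fi by (simp add: finite_index_subgroup_def)
  moreover have "rep ` (rcosets K) \<subseteq> carrier G" using rep by auto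
  ultimately show "subgroup K G \<and>
     (\<exists>F. finite F \<and> F \<subseteq> carrier G \<and> (\<forall>g\<in>carrier G. \<exists>k\<in>K. \<exists>f\<in>F. g = k \<otimes> f))"
    using K by blast
next
  assume "subgroup K G \<and>
     (\<exists>F. finite F \<and> F \<subseteq> carrier G \<and> (\<forall>g\<in>carrier G. \<exists>k\<in>K. \<exists>f\<in>F. g = k \<otimes> f))"
  then obtain F where K: "subgroup K G" and F: "finite F" "F \<subseteq> carrier G"
    and cover: "\<And>g. g \<in> carrier G \<Longrightarrow> \<exists>k\<in>K. \<exists>f\<in>F. g = k \<otimes> f" by blast
  have "rcosets K \<subseteq> (\<lambda>f. K #> f) ` F"
  proof
    fix C assume "C \<in> rcosets K"
    then obtain g where g: "g \<in> carrier G" "C = K #> g" by (auto simp: RCOSETS_def)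
    obtain k f where kf: "k \<in> K" "f \<in> F" "g = k \<otimes> f" using cover[OF g(1)] by blast
    have "g \<in> K #> f" using kf by (auto simp: r_coset_def)
    then have "K #> f = K #> g" using kf F K by (intro repr_independence) auto
    then show "C \<in> (\<lambda>f. K #> f) ` F" using g kf by blast
  qed
  then show "fi K" using K F(1) by (auto simp: finite_index_subgroup_def intro: finite_subset)
qed

lemma fi_carrier: "fi (carrier G)"
  unfolding fi_iff_transversal
  by (intro conjI exI[of _ "{\<one>}"]) (auto simp: subgroup_self)

lemma fi_Int:
  assumes "fi H" "fi K"
  shows "fi (H \<inter> K)"
proof -
  have H: "H \<subseteq> carrier G" and K: "K \<subseteq> carrier G" using assms by (simp_all add: fi_subset)
  have "(H \<inter> K) #> g = (H #> g) \<inter> (K #> g)" if "g \<in> carrier G" for g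
  proof
    show "(H #> g) \<inter> (K #> g) \<subseteq> (H \<inter> K) #> g"
    proof
      fix x assume "x \<in> (H #> g) \<inter> (K #> g)"
      then obtain h k where hk: "h \<in> H" "k \<in> K" "x = h \<otimes> g" "x = k \<otimes> g" by (auto simp: r_coset_def)
      then have "h = k" using that H K by (metis r_cancel subsetD)
      then show "x \<in> (H \<inter> K) #> g" using hk by (auto simp: r_coset_def)
    qed
  qed (auto simp: r_coset_def)
  then have "rcosets (H \<inter> K) \<subseteq> (\<lambda>(A, B). A \<inter> B) ` ((rcosets H) \<times> (rcosets K))"
    by (auto simp: RCOSETS_def)
  moreover have "finite ((\<lambda>(A, B). A \<inter> B) ` ((rcosets H) \<times> (rcosets K)))"
    using assms by (simp add: finite_index_subgroup_def)
  ultimately have "finite (rcosets (H \<inter> K))" by (rule finite_subset)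
  then show ?thesis
    using assms subgroups_Inter_pair by (simp add: finite_index_subgroup_def)
qed

lemma fi_power_mem:
  assumes K: "fi K" and g: "g \<in> carrier G"
  obtains n :: nat where "0 < n" "g [^] n \<in> K"
proof -
  have "range (\<lambda>n::nat. K #> g [^] n) \<subseteq> rcosets K" using g by (auto simp: RCOSETS_def)
  then have "finite (range (\<lambda>n::nat. K #> g [^] n))"
    using K by (auto simp: finite_index_subgroup_def intro: finite_subset)
  then have "\<not> inj (\<lambda>n::nat. K #> g [^] n)" using finite_imageD by blast
  then obtain i j :: nat where ij: "i < j" "K #> g [^] i = K #> g [^] j"
    unfolding inj_def by (metis linorder_neqE_nat)
  have "g [^] j \<in> K #> g [^] i"
    unfolding ij using g K by (intro rcos_self fi_subgroup) auto
  then obtain k where k: "k \<in> K" "g [^] j = k \<otimes> g [^] i" by (auto simp: r_coset_def)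
  have "g [^] j = g [^] (j - i) \<otimes> g [^] i" using g ij by (simp add: nat_pow_mult)
  then have "g [^] (j - i) = k" using k g fi_subset[OF K] by (metis nat_pow_closed r_cancel subsetD)
  then show ?thesis using that[of "j - i"] k ij by simp
qed

lemma commensurations_iff:
  "(H1, H2, \<phi>) \<in> commensurations G \<longleftrightarrow> fi H1 \<and> fi H2 \<and> \<phi> ` H1 = H2 \<and> inj_on \<phi> H1 \<and>
     (\<forall>x\<in>H1. \<forall>y\<in>H1. \<phi> (x \<otimes> y) = \<phi> x \<otimes> \<phi> y)"
  by (auto simp: commensurations_def iso_def hom_def bij_betw_def)

lemma
  assumes "(H1, H2, \<phi>) \<in> commensurations G"
  shows commens_dom: "fi H1" and commens_cod: "fi H2" and commens_image: "\<phi> ` H1 = H2"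
    and commens_inj: "inj_on \<phi> H1"
    and commens_mult: "x \<in> H1 \<Longrightarrow> y \<in> H1 \<Longrightarrow> \<phi> (x \<otimes> y) = \<phi> x \<otimes> \<phi> y"
    and commens_mem: "x \<in> H1 \<Longrightarrow> \<phi> x \<in> H2"
    and commens_closed: "x \<in> H1 \<Longrightarrow> \<phi> x \<in> carrier G"
  using assms fi_subset[of H2] unfolding commensurations_iff by blast+

lemma commens_group_hom:
  assumes c: "(H1, H2, \<phi>) \<in> commensurations G"
  shows "group_hom (G\<lparr>carrier := H1\<rparr>) G \<phi>"
proof -
  have "\<phi> \<in> hom (G\<lparr>carrier := H1\<rparr>) G"
    using commens_mult[OF c] commens_closed[OF c] by (auto simp: hom_def)
  then show ?thesis
    using subgroup.subgroup_is_group[OF fi_subgroup[OF commens_dom[OF c]]] is_group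
    by (simp add: group_hom_def group_hom_axioms_def)
qed

lemma
  assumes c: "(H1, H2, \<phi>) \<in> commensurations G"
  shows commens_one: "\<phi> \<one> = \<one>"
    and commens_inv: "x \<in> H1 \<Longrightarrow> \<phi> (inv x) = inv (\<phi> x)"
    and commens_int_pow: "x \<in> H1 \<Longrightarrow> \<phi> (x [^] (k::int)) = \<phi> x [^] k"
    and commens_nat_pow: "x \<in> H1 \<Longrightarrow> \<phi> (x [^] (n::nat)) = \<phi> x [^] n"
proof -
  have H1: "subgroup H1 G" using commens_dom[OF c] by (rule fi_subgroup)
  interpret h: group_hom "G\<lparr>carrier := H1\<rparr>" G \<phi> using c by (rule commens_group_hom)
  show "\<phi> \<one> = \<one>" using h.hom_one by simp
  show "\<phi> (inv x) = inv (\<phi> x)" if "x \<in> H1" using h.hom_inv[of x] that H1 by simp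
  show "\<phi> (x [^] (k::int)) = \<phi> x [^] k" if "x \<in> H1"
    using h.hom_int_pow[of x k] that int_pow_consistent[OF H1 that, of k] by simp
  show "\<phi> (x [^] (n::nat)) = \<phi> x [^] n" if "x \<in> H1"
    using h.hom_nat_pow[of x n] that nat_pow_consistent[of x n H1] by simp
qed

text \<open>The image of a transversal of \<open>K\<close> in \<open>H1\<close> is one of \<open>\<phi> ` K\<close> in \<open>H2\<close>; multiplying it
  with a transversal of \<open>H2\<close> in \<open>G\<close> gives a transversal of \<open>\<phi> ` K\<close> in \<open>G\<close>.\<close>

lemma commens_image_fi:
  assumes c: "(H1, H2, \<phi>) \<in> commensurations G" and K: "fi K" "K \<subseteq> H1"
  shows "fi (\<phi> ` K)"
proof -
  have sK: "subgroup K G" and sH: "subgroup H1 G" using K commens_dom[OF c] by (auto intro: fi_subgroup)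
  have KG: "K \<subseteq> carrier G" using K by (simp add: fi_subset)
  have sub: "subgroup (\<phi> ` K) G"
  proof (rule subgroupI)
    show "\<phi> ` K \<subseteq> carrier G" using commens_closed[OF c] K by blast
    show "\<phi> ` K \<noteq> {}" using subgroup.one_closed[OF sK] by blast
    show "inv a \<in> \<phi> ` K" if a: "a \<in> \<phi> ` K" for a
    proof -
      obtain x where x: "x \<in> K" "a = \<phi> x" using a by blast
      then have "inv a = \<phi> (inv x)" using commens_inv[OF c] K by auto
      then show ?thesis using x subgroup.m_inv_closed[OF sK] by blast
    qed
    show "a \<otimes> b \<in> \<phi> ` K" if ab: "a \<in> \<phi> ` K" "b \<in> \<phi> ` K" for a b
    proof -
      obtain x y where x: "x \<in> K" "a = \<phi> x" "y \<in> K" "b = \<phi> y" using ab by blast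
      then have "a \<otimes> b = \<phi> (x \<otimes> y)" using commens_mult[OF c] K by (simp add: subset_iff)
      then show ?thesis using x subgroup.m_closed[OF sK] by blast
    qed
  qed
  obtain F where F: "finite F" "F \<subseteq> carrier G" "\<And>g. g \<in> carrier G \<Longrightarrow> \<exists>k\<in>K. \<exists>f\<in>F. g = k \<otimes> f"
    using K(1) unfolding fi_iff_transversal by blast
  obtain F' where F': "finite F'" "F' \<subseteq> carrier G" "\<And>g. g \<in> carrier G \<Longrightarrow> \<exists>k\<in>H2. \<exists>f\<in>F'. g = k \<otimes> f"
    using commens_cod[OF c] unfolding fi_iff_transversal by blast
  \<comment> \<open>the representatives in \<open>F\<close> of cosets that meet \<open>H1\<close> lie in \<open>H1\<close>, as \<open>K\<close> does\<close>
  define E where "E = (\<lambda>(a, b). \<phi> a \<otimes> b) ` ((F \<inter> H1) \<times> F')"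
  have "\<exists>k\<in>\<phi> ` K. \<exists>e\<in>E. g = k \<otimes> e" if g: "g \<in> carrier G" for g
  proof -
    obtain h f' where f': "h \<in> H2" "f' \<in> F'" "g = h \<otimes> f'" using F'(3)[OF g] by blast
    obtain x where x: "x \<in> H1" "h = \<phi> x" using f' commens_image[OF c] by blast
    have xG: "x \<in> carrier G" using x fi_subset[OF commens_dom[OF c]] by blast
    obtain k f where kf: "k \<in> K" "f \<in> F" "x = k \<otimes> f" using F(3)[OF xG] by blast
    have kG: "k \<in> carrier G" "k \<in> H1" "f \<in> carrier G" using kf K KG F by auto
    have "f = inv k \<otimes> x" using kf kG by (simp add: cancel_inv_left)
    then have f: "f \<in> H1" using kG x sH by (simp add: subgroup.m_closed subgroup.m_inv_closed)
    have "g = \<phi> k \<otimes> (\<phi> f \<otimes> f')"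
      using f' x kf f kG F'(2) commens_mult[OF c] commens_closed[OF c] by (auto simp: m_assoc subset_iff)
    moreover have "\<phi> f \<otimes> f' \<in> E" using kf f f' by (auto simp: E_def)
    ultimately show ?thesis using kf by blast
  qed
  moreover have "finite E" using F F' by (simp add: E_def)
  moreover have "E \<subseteq> carrier G" using F' commens_closed[OF c] by (auto simp: E_def)
  ultimately show ?thesis using sub unfolding fi_iff_transversal by blast
qed

lemma commens_inverse:
  assumes c: "(H1, H2, \<phi>) \<in> commensurations G"
  shows "(H2, H1, inv_into H1 \<phi>) \<in> commensurations G"
proof -
  interpret H: group "G\<lparr>carrier := H1\<rparr>"
    using subgroup.subgroup_is_group[OF fi_subgroup[OF commens_dom[OF c]]] is_group .
  show ?thesis
    using c H.iso_set_sym[of \<phi> "G\<lparr>carrier := H2\<rparr>"] by (auto simp: commensurations_def)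
qed

lemma commens_vimage_fi:
  assumes c: "(H1, H2, \<phi>) \<in> commensurations G" and K: "fi K"
  shows "fi {x \<in> H1. \<phi> x \<in> K}"
proof -
  have "{x \<in> H1. \<phi> x \<in> K} = inv_into H1 \<phi> ` (H2 \<inter> K)"
    using commens_inj[OF c] commens_image[OF c] by (force simp: image_iff inv_into_into)
  moreover have "fi (inv_into H1 \<phi> ` (H2 \<inter> K))"
    using commens_image_fi[OF commens_inverse[OF c] fi_Int[OF commens_cod[OF c] K]] by simp
  ultimately show ?thesis by simp
qed

lemma commens_comp:
  assumes c: "c \<in> commensurations G" and d: "d \<in> commensurations G"
  shows "comm_comp c d \<in> commensurations G"
proof -
  obtain K1 K2 \<psi> where cc: "c = (K1, K2, \<psi>)" by (cases c) auto
  obtain H1 H2 \<phi> where dd: "d = (H1, H2, \<phi>)" by (cases d) auto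
  note c = c[unfolded cc] and d = d[unfolded dd]
  let ?D = "{x \<in> H1. \<phi> x \<in> K1}"
  have fD: "fi ?D" using commens_vimage_fi[OF d commens_dom[OF c]] .
  have im: "\<phi> ` ?D = H2 \<inter> K1" using commens_image[OF d] by auto
  have f2: "fi (\<psi> ` (H2 \<inter> K1))"
    using commens_image_fi[OF c fi_Int[OF commens_cod[OF d] commens_dom[OF c]]] by simp
  have "inj_on (\<psi> \<circ> \<phi>) ?D"
    using commens_inj[OF d] commens_inj[OF c] im by (auto simp: inj_on_def)
  moreover have "(\<psi> \<circ> \<phi>) ` ?D = \<psi> ` (H2 \<inter> K1)" using im by (simp only: image_comp[symmetric])
  ultimately show ?thesis using fD f2 commens_mult[OF c] commens_mult[OF d]
    by (simp add: cc dd commensurations_iff)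
qed

lemma commens_id: "(carrier G, carrier G, id) \<in> commensurations G"
  using fi_carrier by (simp add: commensurations_iff)

section \<open>The commensurator group\<close>

lemma comm_rel_iff:
  "((H1, H2, \<phi>), (H1', H2', \<phi>')) \<in> comm_rel G \<longleftrightarrow>
     (H1, H2, \<phi>) \<in> commensurations G \<and> (H1', H2', \<phi>') \<in> commensurations G \<and>
     (\<exists>H. fi H \<and> H \<subseteq> H1 \<inter> H1' \<and> (\<forall>x\<in>H. \<phi> x = \<phi>' x))"
  by (simp add: comm_rel_def)

lemma comm_rel_equiv: "equiv (commensurations G) (comm_rel G)"
proof (rule equivI)
  show "comm_rel G \<subseteq> commensurations G \<times> commensurations G" by (auto simp: comm_rel_def)
  show "refl_on (commensurations G) (comm_rel G)"
    by (auto simp: refl_on_def comm_rel_def intro: commens_dom)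
  show "sym (comm_rel G)"
  proof (rule symI, clarify)
    fix H1 H2 \<phi> K1 K2 \<psi>
    assume "((H1, H2, \<phi>), (K1, K2, \<psi>)) \<in> comm_rel G"
    then show "((K1, K2, \<psi>), (H1, H2, \<phi>)) \<in> comm_rel G"
      unfolding comm_rel_iff by (metis Int_commute)
  qed
  show "trans (comm_rel G)"
  proof (rule transI, clarify)
    fix H1 H2 \<phi> K1 K2 \<psi> L1 L2 \<theta>
    assume 1: "((H1, H2, \<phi>), (K1, K2, \<psi>)) \<in> comm_rel G" and 2: "((K1, K2, \<psi>), (L1, L2, \<theta>)) \<in> comm_rel G"
    obtain A where A: "fi A" "A \<subseteq> H1 \<inter> K1" "\<forall>x\<in>A. \<phi> x = \<psi> x" using 1 unfolding comm_rel_iff by blast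
    obtain B where B: "fi B" "B \<subseteq> K1 \<inter> L1" "\<forall>x\<in>B. \<psi> x = \<theta> x" using 2 unfolding comm_rel_iff by blast
    have "fi (A \<inter> B)" using A B by (intro fi_Int)
    moreover have "A \<inter> B \<subseteq> H1 \<inter> L1" "\<forall>x\<in>A \<inter> B. \<phi> x = \<theta> x" using A B by auto
    ultimately show "((H1, H2, \<phi>), (L1, L2, \<theta>)) \<in> comm_rel G"
      using 1 2 unfolding comm_rel_iff by blast
  qed
qed

lemma comm_class_eq_iff:
  assumes "c \<in> commensurations G" "d \<in> commensurations G"
  shows "comm_class G c = comm_class G d \<longleftrightarrow> (c, d) \<in> comm_rel G"
  unfolding comm_class_def using eq_equiv_class_iff[OF comm_rel_equiv] assms by simp

lemma comm_class_eqI: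
  assumes "(H1, H2, \<phi>) \<in> commensurations G" "(H1', H2', \<phi>') \<in> commensurations G"
    "fi H" "H \<subseteq> H1" "H \<subseteq> H1'" "\<And>x. x \<in> H \<Longrightarrow> \<phi> x = \<phi>' x"
  shows "comm_class G (H1, H2, \<phi>) = comm_class G (H1', H2', \<phi>')"
  using assms by (subst comm_class_eq_iff) (auto simp: comm_rel_iff)

lemma comm_rel_comp:
  assumes "(c, c') \<in> comm_rel G" "(d, d') \<in> comm_rel G"
  shows "(comm_comp c d, comm_comp c' d') \<in> comm_rel G"
proof -
  obtain K1 K2 \<psi> where cc: "c = (K1, K2, \<psi>)" by (cases c) auto
  obtain H1 H2 \<phi> where dd: "d = (H1, H2, \<phi>)" by (cases d) auto
  obtain K1' K2' \<psi>' where cc': "c' = (K1', K2', \<psi>')" by (cases c') auto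
  obtain H1' H2' \<phi>' where dd': "d' = (H1', H2', \<phi>')" by (cases d') auto
  have com: "c \<in> commensurations G" "c' \<in> commensurations G"
    "d \<in> commensurations G" "d' \<in> commensurations G"
    using assms by (auto simp: comm_rel_def)
  obtain L where L: "fi L" "L \<subseteq> K1 \<inter> K1'" "\<forall>x\<in>L. \<psi> x = \<psi>' x"
    using assms(1) unfolding cc cc' comm_rel_iff by blast
  obtain M where M: "fi M" "M \<subseteq> H1 \<inter> H1'" "\<forall>x\<in>M. \<phi> x = \<phi>' x"
    using assms(2) unfolding dd dd' comm_rel_iff by blast
  have "fi (M \<inter> {x \<in> H1. \<phi> x \<in> L})"
    using M(1) commens_vimage_fi[OF com(3)[unfolded dd] L(1)] by (rule fi_Int)
  moreover have "M \<inter> {x \<in> H1. \<phi> x \<in> L} \<subseteq> {x \<in> H1. \<phi> x \<in> K1} \<inter> {x \<in> H1'. \<phi>' x \<in> K1'}"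
    using L(2) M(2,3) by auto
  moreover have "\<forall>x\<in>M \<inter> {x \<in> H1. \<phi> x \<in> L}. (\<psi> \<circ> \<phi>) x = (\<psi>' \<circ> \<phi>') x"
    using L(3) M(3) by auto
  ultimately show ?thesis
    using commens_comp[OF com(1,3)] commens_comp[OF com(2,4)]
    unfolding cc dd cc' dd' comm_comp.simps comm_rel_iff by blast
qed

lemma Comm_carrier: "carrier (Comm G) = comm_class G ` commensurations G"
  by (auto simp: Comm_def quotient_def comm_class_def)

lemma Comm_one: "\<one>\<^bsub>Comm G\<^esub> = comm_class G (carrier G, carrier G, id)"
  by (simp add: Comm_def)

lemma comm_class_self: "c \<in> commensurations G \<Longrightarrow> c \<in> comm_class G c"
  using equiv_class_self[OF comm_rel_equiv] by (simp add: comm_class_def)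

lemma comm_classD: "d \<in> comm_class G c \<Longrightarrow> (c, d) \<in> comm_rel G"
  by (simp add: comm_class_def)

lemma Comm_mult:
  assumes c: "c \<in> commensurations G" and d: "d \<in> commensurations G"
  shows "comm_class G c \<otimes>\<^bsub>Comm G\<^esub> comm_class G d = comm_class G (comm_comp c d)"
proof -
  have "comm_class G (comm_comp c' d') = comm_class G (comm_comp c d)"
    if "c' \<in> comm_class G c" "d' \<in> comm_class G d" for c' d'
  proof -
    have "(comm_comp c d, comm_comp c' d') \<in> comm_rel G"
      using that by (intro comm_rel_comp comm_classD)
    then show ?thesis
      unfolding comm_class_def by (metis equiv_class_eq[OF comm_rel_equiv])
  qed
  with comm_class_self[OF c] comm_class_self[OF d]
  have "(\<Union>c'\<in>comm_class G c. \<Union>d'\<in>comm_class G d. comm_class G (comm_comp c' d'))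
    = comm_class G (comm_comp c d)" by (rule UN_UN_constant)
  then show ?thesis by (simp add: Comm_def)
qed

lemma Comm_group: "group (Comm G)"
proof (rule groupI)
  fix C D E assume "C \<in> carrier (Comm G)" "D \<in> carrier (Comm G)"
  then obtain c d where c: "c \<in> commensurations G" "C = comm_class G c"
    and d: "d \<in> commensurations G" "D = comm_class G d" by (auto simp: Comm_carrier)
  then show "C \<otimes>\<^bsub>Comm G\<^esub> D \<in> carrier (Comm G)"
    by (simp add: Comm_mult Comm_carrier commens_comp)
  assume "E \<in> carrier (Comm G)"
  then obtain e where e: "e \<in> commensurations G" "E = comm_class G e" by (auto simp: Comm_carrier)
  obtain H1 H2 \<phi> where ee: "e = (H1, H2, \<phi>)" by (cases e) auto
  obtain K1 K2 \<psi> where dd: "d = (K1, K2, \<psi>)" by (cases d) auto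
  obtain L1 L2 \<theta> where cc: "c = (L1, L2, \<theta>)" by (cases c) auto
  let ?D = "{x \<in> {x \<in> H1. \<phi> x \<in> K1}. \<psi> (\<phi> x) \<in> L1}"
  have 1: "comm_comp (comm_comp c d) e \<in> commensurations G"
    and 2: "comm_comp c (comm_comp d e) \<in> commensurations G"
    using c d e by (simp_all add: commens_comp)
  have D: "{x \<in> H1. \<phi> x \<in> {x \<in> K1. \<psi> x \<in> L1}} = ?D" by auto
  have "fi ?D" using 2 by (simp add: cc dd ee commensurations_iff)
  then have "comm_class G (comm_comp (comm_comp c d) e) = comm_class G (comm_comp c (comm_comp d e))"
    using 1 2 unfolding cc dd ee comm_comp.simps D
    by (intro comm_class_eqI[where H = ?D]) auto
  then show "C \<otimes>\<^bsub>Comm G\<^esub> D \<otimes>\<^bsub>Comm G\<^esub> E = C \<otimes>\<^bsub>Comm G\<^esub> (D \<otimes>\<^bsub>Comm G\<^esub> E)"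
    using c d e by (simp add: Comm_mult commens_comp)
next
  show "\<one>\<^bsub>Comm G\<^esub> \<in> carrier (Comm G)" using commens_id by (auto simp: Comm_one Comm_carrier)
next
  fix C assume "C \<in> carrier (Comm G)"
  then obtain H1 H2 \<phi> where c: "(H1, H2, \<phi>) \<in> commensurations G" "C = comm_class G (H1, H2, \<phi>)"
    by (auto simp: Comm_carrier)
  let ?i = "(H2, H1, inv_into H1 \<phi>)"
  have i: "?i \<in> commensurations G" using commens_inverse[OF c(1)] .
  have H1: "H1 \<subseteq> carrier G" "fi H1" using commens_dom[OF c(1)] by (auto simp: fi_subset)
  have "comm_class G (comm_comp (carrier G, carrier G, id) (H1, H2, \<phi>)) = C"
    using commens_comp[OF commens_id c(1)] c H1 commens_closed[OF c(1)]
    unfolding c(2) comm_comp.simps by (intro comm_class_eqI[where H = H1]) auto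
  then show "\<one>\<^bsub>Comm G\<^esub> \<otimes>\<^bsub>Comm G\<^esub> C = C"
    using c by (simp add: Comm_one Comm_mult commens_id del: comm_comp.simps)
  have "comm_class G (comm_comp ?i (H1, H2, \<phi>)) = \<one>\<^bsub>Comm G\<^esub>"
    using commens_comp[OF i c(1)] commens_id H1 commens_mem[OF c(1)] commens_inj[OF c(1)]
    unfolding Comm_one comm_comp.simps by (intro comm_class_eqI[where H = H1]) auto
  then have "comm_class G ?i \<otimes>\<^bsub>Comm G\<^esub> C = \<one>\<^bsub>Comm G\<^esub>"
    using c i by (simp add: Comm_mult del: comm_comp.simps)
  then show "\<exists>D\<in>carrier (Comm G). D \<otimes>\<^bsub>Comm G\<^esub> C = \<one>\<^bsub>Comm G\<^esub>"
    using i by (auto simp: Comm_carrier)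
qed

end

section \<open>The action on virtual left-orderings\<close>

text \<open>Bijectivity comes for free: the inverse group element acts as the inverse map.\<close>

lemma group_actionI:
  assumes M: "group M"
    and ext: "\<And>g. g \<in> carrier M \<Longrightarrow> f g \<in> extensional E"
    and clos: "\<And>g x. g \<in> carrier M \<Longrightarrow> x \<in> E \<Longrightarrow> f g x \<in> E"
    and mult: "\<And>g h x. g \<in> carrier M \<Longrightarrow> h \<in> carrier M \<Longrightarrow> x \<in> E \<Longrightarrow> f (g \<otimes>\<^bsub>M\<^esub> h) x = f g (f h x)"
    and one: "\<And>x. x \<in> E \<Longrightarrow> f \<one>\<^bsub>M\<^esub> x = x"
  shows "group_action M E f"
proof -
  interpret M: group M by fact
  have bij: "f g \<in> Bij E" if g: "g \<in> carrier M" for g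
  proof -
    have "bij_betw (f g) E E"
    proof (rule bij_betw_byWitness[where f' = "f (inv\<^bsub>M\<^esub> g)"])
      show "\<forall>x\<in>E. f (inv\<^bsub>M\<^esub> g) (f g x) = x" using g one by (simp flip: mult)
      show "\<forall>x\<in>E. f g (f (inv\<^bsub>M\<^esub> g) x) = x" using g one by (simp flip: mult)
    qed (use g clos in auto)
    then show ?thesis using ext[OF g] by (simp add: Bij_def)
  qed
  have "f \<in> hom M (BijGroup E)"
  proof (rule homI)
    show "f g \<in> carrier (BijGroup E)" if "g \<in> carrier M" for g
      using bij[OF that] by (simp add: BijGroup_def)
    show "f (g \<otimes>\<^bsub>M\<^esub> h) = f g \<otimes>\<^bsub>BijGroup E\<^esub> f h" if "g \<in> carrier M" "h \<in> carrier M" for g h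
    proof (rule extensionalityI)
      show "f (g \<otimes>\<^bsub>M\<^esub> h) \<in> extensional E" using that by (intro ext) simp
      show "f g \<otimes>\<^bsub>BijGroup E\<^esub> f h \<in> extensional E"
        using bij that by (simp add: BijGroup_def)
      show "f (g \<otimes>\<^bsub>M\<^esub> h) x = (f g \<otimes>\<^bsub>BijGroup E\<^esub> f h) x" if "x \<in> E" for x
        using bij that \<open>g \<in> carrier M\<close> \<open>h \<in> carrier M\<close>
        by (simp add: BijGroup_def compose_eq mult)
    qed
  qed
  then show ?thesis
    using M group_BijGroup by (simp add: group_action_def group_hom_def group_hom_axioms_def)
qed

context group
begin

lemma virtual_cones_iff: "(H, P) \<in> virtual_cones G \<longleftrightarrow> fi H \<and> is_cone H P"
  by (auto simp: virtual_cones_def LO_subgroup_iff fi_subgroup)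

lemma cone_restrict:
  assumes "is_cone H P" "subgroup K G" "K \<subseteq> H"
  shows "is_cone K (P \<inter> K)"
  using assms subgroup.m_closed[OF assms(2)] subgroup.m_inv_closed[OF assms(2)]
  unfolding is_cone_def by blast

lemma cone_image:
  assumes c: "(H1, H2, \<phi>) \<in> commensurations G" and P: "is_cone K P" and K: "K \<subseteq> H1"
  shows "is_cone (\<phi> ` K) (\<phi> ` P)"
  unfolding is_cone_def
proof (intro conjI ballI)
  have PK: "P \<subseteq> K" using P by (rule is_cone_subset)
  then show "\<phi> ` P \<subseteq> \<phi> ` K" by blast
  show "\<one> \<notin> \<phi> ` P"
  proof
    assume "\<one> \<in> \<phi> ` P"
    then obtain x where x: "x \<in> P" "\<phi> x = \<phi> \<one>" using commens_one[OF c] by auto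
    have "x \<in> H1" using x PK K by blast
    moreover have "\<one> \<in> H1" using subgroup.one_closed[OF fi_subgroup[OF commens_dom[OF c]]] .
    ultimately have "x = \<one>" using x(2) commens_inj[OF c] by (simp add: inj_on_eq_iff)
    then show False using x(1) is_cone_one[OF P] by simp
  qed
  show "x \<otimes> y \<in> \<phi> ` P" if xy: "x \<in> \<phi> ` P" "y \<in> \<phi> ` P" for x y
  proof -
    obtain a b where ab: "a \<in> P" "x = \<phi> a" "b \<in> P" "y = \<phi> b" using xy by blast
    then have "a \<in> H1" "b \<in> H1" using PK K by auto
    then have "x \<otimes> y = \<phi> (a \<otimes> b)" using commens_mult[OF c] ab by simp
    then show ?thesis using is_cone_mult[OF P] ab by blast
  qed
  show "x = \<one> \<or> x \<in> \<phi> ` P \<or> inv x \<in> \<phi> ` P" if x: "x \<in> \<phi> ` K" for x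
  proof -
    obtain a where a: "a \<in> K" "x = \<phi> a" using x by blast
    then have "inv x = \<phi> (inv a)" using commens_inv[OF c] K by auto
    then show ?thesis using is_cone_total[OF P a(1)] a commens_one[OF c] by auto
  qed
qed

lemma vlo_rel_iff:
  "((H, P), (H', P')) \<in> vlo_rel G \<longleftrightarrow>
     (H, P) \<in> virtual_cones G \<and> (H', P') \<in> virtual_cones G \<and>
     (\<exists>K. fi K \<and> K \<subseteq> H \<inter> H' \<and> P \<inter> K = P' \<inter> K)"
  by (simp add: vlo_rel_def)

lemma vlo_rel_equiv: "equiv (virtual_cones G) (vlo_rel G)"
proof (rule equivI)
  show "vlo_rel G \<subseteq> virtual_cones G \<times> virtual_cones G" by (auto simp: vlo_rel_def)
  show "refl_on (virtual_cones G) (vlo_rel G)"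
  proof (rule refl_onI, clarify)
    fix H P assume "(H, P) \<in> virtual_cones G"
    then show "((H, P), (H, P)) \<in> vlo_rel G" unfolding vlo_rel_iff virtual_cones_iff by blast
  qed
  show "sym (vlo_rel G)"
  proof (rule symI, clarify)
    fix H P H' P' assume "((H, P), (H', P')) \<in> vlo_rel G"
    then show "((H', P'), (H, P)) \<in> vlo_rel G" unfolding vlo_rel_iff by (metis Int_commute)
  qed
  show "trans (vlo_rel G)"
  proof (rule transI, clarify)
    fix H P H' P' H'' P''
    assume 1: "((H, P), (H', P')) \<in> vlo_rel G" and 2: "((H', P'), (H'', P'')) \<in> vlo_rel G"
    obtain A where A: "fi A" "A \<subseteq> H \<inter> H'" "P \<inter> A = P' \<inter> A" using 1 unfolding vlo_rel_iff by blast
    obtain B where B: "fi B" "B \<subseteq> H' \<inter> H''" "P' \<inter> B = P'' \<inter> B" using 2 unfolding vlo_rel_iff by blast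
    have "fi (A \<inter> B)" using A B by (intro fi_Int)
    moreover have "A \<inter> B \<subseteq> H \<inter> H''" "P \<inter> (A \<inter> B) = P'' \<inter> (A \<inter> B)" using A B by blast+
    ultimately show "((H, P), (H'', P'')) \<in> vlo_rel G"
      using 1 2 unfolding vlo_rel_iff by blast
  qed
qed

text \<open>The action on representatives, before passing to classes.\<close>

fun push_cone :: "'a commensuration \<Rightarrow> 'a set \<times> 'a set \<Rightarrow> 'a set \<times> 'a set" where
  "push_cone (H1, H2, \<phi>) (H, P) = (\<phi> ` (H \<inter> H1), \<phi> ` (P \<inter> H1))"

lemma push_cone_closed:
  assumes c: "c \<in> commensurations G" and v: "v \<in> virtual_cones G"
  shows "push_cone c v \<in> virtual_cones G"
proof -
  obtain H1 H2 \<phi> where cc: "c = (H1, H2, \<phi>)" by (cases c) auto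
  obtain H P where vv: "v = (H, P)" by (cases v) auto
  note c = c[unfolded cc]
  have v: "fi H" "is_cone H P" using v unfolding vv virtual_cones_iff by auto
  have K: "fi (H \<inter> H1)" using v(1) commens_dom[OF c] by (rule fi_Int)
  have "P \<inter> H1 = P \<inter> (H \<inter> H1)" using is_cone_subset[OF v(2)] by blast
  then have "is_cone (H \<inter> H1) (P \<inter> H1)"
    using cone_restrict[OF v(2) fi_subgroup[OF K]] by simp
  then have "is_cone (\<phi> ` (H \<inter> H1)) (\<phi> ` (P \<inter> H1))" by (rule cone_image[OF c]) simp
  then show ?thesis using commens_image_fi[OF c K] unfolding cc vv push_cone.simps virtual_cones_iff by simp
qed

lemma push_cone_cong:
  assumes c: "(c, c') \<in> comm_rel G" and v: "(v, v') \<in> vlo_rel G"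
  shows "(push_cone c v, push_cone c' v') \<in> vlo_rel G"
proof -
  obtain H1 H2 \<phi> where cc: "c = (H1, H2, \<phi>)" by (cases c) auto
  obtain H1' H2' \<phi>' where cc': "c' = (H1', H2', \<phi>')" by (cases c') auto
  obtain H P where vv: "v = (H, P)" by (cases v) auto
  obtain H' P' where vv': "v' = (H', P')" by (cases v') auto
  have com: "c \<in> commensurations G" "c' \<in> commensurations G"
    and vir: "v \<in> virtual_cones G" "v' \<in> virtual_cones G"
    using c v by (auto simp: comm_rel_def vlo_rel_def)
  obtain L where L: "fi L" "L \<subseteq> H1 \<inter> H1'" "\<forall>x\<in>L. \<phi> x = \<phi>' x"
    using c unfolding cc cc' comm_rel_iff by blast
  obtain M where M: "fi M" "M \<subseteq> H \<inter> H'" "P \<inter> M = P' \<inter> M"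
    using v unfolding vv vv' vlo_rel_iff by blast
  have sub: "L \<inter> M \<subseteq> H \<inter> H1" "L \<inter> M \<subseteq> H' \<inter> H1'" using L M by auto
  have K: "fi (\<phi> ` (L \<inter> M))"
    using commens_image_fi[OF com(1)[unfolded cc] fi_Int[OF L(1) M(1)]] sub by blast
  have eq: "\<phi> ` A = \<phi>' ` A" if "A \<subseteq> L \<inter> M" for A using that L(3) by (intro image_cong) auto
  have "\<phi> ` (P \<inter> H1) \<inter> \<phi> ` (L \<inter> M) = \<phi> ` (P \<inter> H1 \<inter> (L \<inter> M))"
    using commens_inj[OF com(1)[unfolded cc]] sub by (intro inj_on_image_Int[symmetric]) auto
  also have "P \<inter> H1 \<inter> (L \<inter> M) = P' \<inter> H1' \<inter> (L \<inter> M)" using L M by blast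
  also have "\<phi> ` \<dots> = \<phi>' ` \<dots>" by (intro eq) auto
  also have "\<dots> = \<phi>' ` (P' \<inter> H1') \<inter> \<phi>' ` (L \<inter> M)"
    using commens_inj[OF com(2)[unfolded cc']] sub by (intro inj_on_image_Int) auto
  also have "\<phi>' ` (L \<inter> M) = \<phi> ` (L \<inter> M)" using eq by blast
  finally have "\<phi> ` (P \<inter> H1) \<inter> \<phi> ` (L \<inter> M) = \<phi>' ` (P' \<inter> H1') \<inter> \<phi> ` (L \<inter> M)" .
  moreover have "\<phi> ` (L \<inter> M) \<subseteq> \<phi> ` (H \<inter> H1) \<inter> \<phi>' ` (H' \<inter> H1')"
    using sub eq[OF subset_refl] by blast
  ultimately show ?thesis
    using K push_cone_closed[OF com(1) vir(1)] push_cone_closed[OF com(2) vir(2)]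
    unfolding cc cc' vv vv' push_cone.simps vlo_rel_iff by blast
qed

text \<open>This holds on the nose for representatives, because the composite of two
  commensurations is defined exactly where the two maps can be applied one after the other.\<close>

lemma push_cone_comp: "push_cone (comm_comp c d) v = push_cone c (push_cone d v)"
proof -
  obtain K1 K2 \<psi> where cc: "c = (K1, K2, \<psi>)" by (cases c) auto
  obtain H1 H2 \<phi> where dd: "d = (H1, H2, \<phi>)" by (cases d) auto
  obtain H P where vv: "v = (H, P)" by (cases v) auto
  have "(\<psi> \<circ> \<phi>) ` (A \<inter> {x \<in> H1. \<phi> x \<in> K1}) = \<psi> ` (\<phi> ` (A \<inter> H1) \<inter> K1)" for A by auto
  then show ?thesis by (simp only: cc dd vv comm_comp.simps push_cone.simps)
qed

lemma VLO_eq: "VLO G = vlo_class G ` virtual_cones G"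
  by (auto simp: VLO_def quotient_def vlo_class_def)

lemma vlo_class_eq_iff:
  assumes "v \<in> virtual_cones G" "w \<in> virtual_cones G"
  shows "vlo_class G v = vlo_class G w \<longleftrightarrow> (v, w) \<in> vlo_rel G"
  unfolding vlo_class_def using eq_equiv_class_iff[OF vlo_rel_equiv] assms by simp

lemma comm_act_class:
  assumes c: "c \<in> commensurations G" and v: "v \<in> virtual_cones G"
  shows "comm_act G (comm_class G c) (vlo_class G v) = vlo_class G (push_cone c v)"
proof -
  have "vlo_class G (push_cone c' v') = vlo_class G (push_cone c v)"
    if "c' \<in> comm_class G c" "v' \<in> vlo_class G v" for c' v'
  proof -
    have "(push_cone c v, push_cone c' v') \<in> vlo_rel G"
      using that by (intro push_cone_cong) (simp_all add: comm_class_def vlo_class_def)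
    then show ?thesis unfolding vlo_class_def by (metis equiv_class_eq[OF vlo_rel_equiv])
  qed
  moreover have "v \<in> vlo_class G v"
    using equiv_class_self[OF vlo_rel_equiv v] by (simp add: vlo_class_def)
  moreover note comm_class_self[OF c]
  ultimately have "(\<Union>c'\<in>comm_class G c. \<Union>v'\<in>vlo_class G v. vlo_class G (push_cone c' v'))
      = vlo_class G (push_cone c v)" by (intro UN_UN_constant)
  moreover have "push_cone c' v' = (case c' of (H1, H2, \<phi>) \<Rightarrow> case v' of (H, P) \<Rightarrow> (\<phi> ` (H \<inter> H1), \<phi> ` (P \<inter> H1)))"
    for c' v' by (cases c'; cases v') auto
  moreover have "vlo_class G v \<in> VLO G" using v by (simp add: VLO_eq)
  ultimately show ?thesis
    by (simp add: comm_act_def case_prod_unfold)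
qed

lemma comm_act_group_action: "group_action (Comm G) (VLO G) (comm_act G)"
proof (rule group_actionI[OF Comm_group])
  show "comm_act G C \<in> extensional (VLO G)" for C by (simp add: comm_act_def)
next
  fix C V assume "C \<in> carrier (Comm G)" "V \<in> VLO G"
  then obtain c v where "c \<in> commensurations G" "C = comm_class G c"
    "v \<in> virtual_cones G" "V = vlo_class G v" unfolding Comm_carrier VLO_eq by blast
  then show "comm_act G C V \<in> VLO G"
    by (simp add: VLO_eq comm_act_class push_cone_closed)
next
  fix C D V assume "C \<in> carrier (Comm G)" "D \<in> carrier (Comm G)" "V \<in> VLO G"
  then obtain c d v where "c \<in> commensurations G" "C = comm_class G c"
    "d \<in> commensurations G" "D = comm_class G d" "v \<in> virtual_cones G" "V = vlo_class G v"
    unfolding Comm_carrier VLO_eq by blast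
  then show "comm_act G (C \<otimes>\<^bsub>Comm G\<^esub> D) V = comm_act G C (comm_act G D V)"
    by (simp add: Comm_mult comm_act_class push_cone_closed commens_comp push_cone_comp)
next
  fix V assume "V \<in> VLO G"
  then obtain H P where v: "(H, P) \<in> virtual_cones G" "V = vlo_class G (H, P)" by (auto simp: VLO_eq)
  then have "H \<subseteq> carrier G" "P \<subseteq> carrier G"
    using is_cone_subset[of H P] fi_subset[of H] by (auto simp: virtual_cones_iff)
  then have "push_cone (carrier G, carrier G, id) (H, P) = (H, P)" by (simp add: Int_absorb2)
  then show "comm_act G \<one>\<^bsub>Comm G\<^esub> V = V"
    using comm_act_class[OF commens_id v(1)] unfolding v(2) Comm_one by simp
qed

lemma comm_act_kernel_iff:
  assumes c: "c \<in> commensurations G"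
  shows "comm_act G (comm_class G c) = \<one>\<^bsub>BijGroup (VLO G)\<^esub> \<longleftrightarrow>
    (\<forall>v\<in>virtual_cones G. (push_cone c v, v) \<in> vlo_rel G)"
proof -
  have "comm_act G (comm_class G c) = \<one>\<^bsub>BijGroup (VLO G)\<^esub> \<longleftrightarrow>
    (\<forall>V\<in>VLO G. comm_act G (comm_class G c) V = V)"
    by (auto simp: BijGroup_def comm_act_def fun_eq_iff)
  also have "\<dots> \<longleftrightarrow> (\<forall>v\<in>virtual_cones G. (push_cone c v, v) \<in> vlo_rel G)"
    by (simp add: VLO_eq comm_act_class[OF c] vlo_class_eq_iff push_cone_closed[OF c])
  finally show ?thesis .
qed

end

section \<open>Kernel elements map each element to a root of one of its powers\<close>

context group
begin

lemma cone_nat_pow: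
  assumes "is_cone H P" "x \<in> P" "x \<in> carrier G" "0 < n"
  shows "x [^] (n::nat) \<in> P"
  using assms(4)
proof (induction n rule: nat_induct_non_zero)
  case 1
  then show ?case using assms by simp
next
  case (Suc n)
  then show ?case using is_cone_mult[OF assms(1) _ assms(2)] by simp
qed

lemma cone_nat_pow_iff:
  assumes P: "is_cone H P" and x: "x \<in> H" "x \<in> carrier G" and n: "0 < n"
  shows "x [^] (n::nat) \<in> P \<longleftrightarrow> x \<in> P"
proof
  assume p: "x [^] n \<in> P"
  consider "x = \<one>" | "x \<in> P" | "inv x \<in> P" using is_cone_total[OF P x(1)] by blast
  then show "x \<in> P"
  proof cases
    case 1
    then show ?thesis using p by simp
  next
    case 3
    have "inv x [^] n \<in> P" using cone_nat_pow[OF P 3 _ n] x by simp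
    then have "x [^] n \<otimes> inv x [^] n \<in> P" using p is_cone_mult[OF P] by blast
    then show ?thesis using is_cone_one[OF P] x by (simp add: nat_pow_inv)
  qed
qed (use cone_nat_pow[OF P _ x(2) n] in blast)

lemma quotient_int_pow:
  assumes "u \<otimes> y = y \<otimes> u" "u \<in> carrier G" "y \<in> carrier G" "u [^] (q::int) = y [^] (p::int)"
  shows "(inv y \<otimes> u) [^] q = y [^] (p - q)"
proof -
  have "inv y \<otimes> u = u \<otimes> inv y"
    using assms(1-3) by (metis inv_solve_left inv_solve_right' inv_closed m_closed m_assoc)
  then have "(inv y \<otimes> u) [^] q = inv y [^] q \<otimes> u [^] q"
    using assms by (intro int_pow_mult_distrib) auto
  also have "\<dots> = y [^] (- q) \<otimes> y [^] p" using assms by (simp add: int_pow_inv int_pow_neg)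
  also have "\<dots> = y [^] (p - q)" using assms by (simp flip: int_pow_mult)
  finally show ?thesis .
qed

text \<open>If conjugation by \<open>z\<close> multiplies the rational line of \<open>g\<close> by \<open>b / a\<close>, then
  conjugation by a power of \<open>z\<close> multiplies it by the power of \<open>b / a\<close>.\<close>

lemma conjugate_pow_scaling:
  assumes "conjugate z (g [^] (a::int)) = g [^] (b::int)" "z \<in> carrier G" "g \<in> carrier G"
  shows "conjugate (z [^] (n::nat)) (g [^] (a ^ n)) = g [^] (b ^ n)"
proof (induction n)
  case (Suc n)
  have "conjugate (z [^] Suc n) (g [^] (a ^ Suc n)) = conjugate (z [^] n) (conjugate z ((g [^] a) [^] (a ^ n)))"
    using assms by (simp add: conjugate_conjugate int_pow_pow)
  also have "\<dots> = conjugate (z [^] n) ((g [^] (a ^ n)) [^] b)"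
    using assms by (simp flip: conjugate_int_pow) (simp add: int_pow_pow mult.commute)
  also have "\<dots> = g [^] (b ^ Suc n)"
    using assms Suc by (simp flip: conjugate_int_pow) (simp add: int_pow_pow mult.commute)
  finally show ?case .
qed (use assms in simp)

end

context bi_ordered_group
begin

text \<open>Otherwise some left-ordering of \<open>G\<close> makes \<open>g\<close> positive and \<open>\<phi> g\<close> negative. A
  power of \<open>\<phi> g\<close> lies in the finite index subgroup on which \<open>\<phi>\<close> preserves this cone; the same power
  of \<open>g\<close> is positive, so that power of \<open>\<phi> g\<close> would be positive, too.\<close>

lemma fixes_cones_imp_proportional:
  assumes c: "(H1, H2, \<phi>) \<in> commensurations G"
    and fixed: "\<And>v. v \<in> virtual_cones G \<Longrightarrow> (push_cone (H1, H2, \<phi>) v, v) \<in> vlo_rel G"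
    and g: "g \<in> H1"
  shows "\<exists>(p::nat) (q::nat). 0 < p \<and> 0 < q \<and> \<phi> g [^] q = g [^] p"
proof (rule ccontr)
  assume neg: "\<not> ?thesis"
  have H1: "subgroup H1 G" using commens_dom[OF c] by (rule fi_subgroup)
  have gG: "g \<in> carrier G" using H1 g by (rule subgroup.mem_carrier)
  have hG: "\<phi> g \<in> carrier G" using commens_closed[OF c g] .
  have g1: "g \<noteq> \<one>"
  proof
    assume "g = \<one>"
    then have "\<phi> g [^] (1::nat) = g [^] (1::nat)" using commens_one[OF c] by simp
    then show False using neg zero_less_one by blast
  qed
  have h1: "\<phi> g \<noteq> \<one>"
    using g1 g commens_one[OF c] commens_inj[OF c] subgroup.one_closed[OF H1]
    by (metis inj_on_eq_iff)
  obtain P where P: "is_cone (carrier G) P" "g \<in> P" "inv (\<phi> g) \<in> P"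
    by (rule cone_separates[OF gG g1 hG h1]) (use neg in blast)+
  have "(carrier G, P) \<in> virtual_cones G" using P fi_carrier by (simp add: virtual_cones_iff)
  then have "(push_cone (H1, H2, \<phi>) (carrier G, P), (carrier G, P)) \<in> vlo_rel G" by (rule fixed)
  then obtain K where K: "fi K" "\<phi> ` (P \<inter> H1) \<inter> K = P \<inter> K"
    unfolding push_cone.simps vlo_rel_iff by blast
  obtain n :: nat where n: "0 < n" "\<phi> g [^] n \<in> K" using fi_power_mem[OF K(1) hG] .
  have "g [^] n \<in> P" using cone_nat_pow[OF P(1,2) gG n(1)] .
  moreover have "g [^] n \<in> H1"
  proof -
    have "g [^] m \<in> H1" for m :: nat
      using g subgroup.one_closed[OF H1] subgroup.m_closed[OF H1] by (induction m) auto
    then show ?thesis .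
  qed
  ultimately have "\<phi> (g [^] n) \<in> \<phi> ` (P \<inter> H1)" by blast
  then have "\<phi> g [^] n \<in> P" using K(2) n(2) commens_nat_pow[OF c g] by auto
  then have "\<phi> g \<in> P" using cone_nat_pow_iff[OF P(1) hG hG n(1)] by simp
  then have "\<phi> g \<otimes> inv (\<phi> g) \<in> P" using P is_cone_mult[OF P(1)] by blast
  then show False using is_cone_one[OF P(1)] hG by simp
qed

section \<open>The ratio of a kernel element\<close>

text \<open>Compute a common power of \<open>\<phi> (x \<otimes> y) = \<phi> x \<otimes> \<phi> y\<close> in two ways. Either the exponents of \<open>x\<close> agree,
  and then so do those of \<open>y\<close> (unless \<open>y = \<one>\<close>), which means that \<open>x\<close> and \<open>y\<close> both have the ratio of \<open>x \<otimes> y\<close>; or \<open>x\<close> and \<open>y\<close>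
  have a common nontrivial power \<open>x\<^sup>d = y\<^sup>e\<close>, and the ratio of an element is that of its powers. The
  exponents are integers since \<open>d\<close> and \<open>e\<close> can have either sign.\<close>

lemma proportional_commuting:
  assumes c: "(H1, H2, \<phi>) \<in> commensurations G"
    and scales: "\<And>g. g \<in> H1 \<Longrightarrow> \<exists>(p::int) (q::int). 0 < p \<and> 0 < q \<and> \<phi> g [^] q = g [^] p"
    and x: "x \<in> H1" "x \<noteq> \<one>" and y: "y \<in> H1" and comm: "x \<otimes> y = y \<otimes> x"
    and pq: "\<phi> x [^] (q::int) = x [^] (p::int)" "0 < q"
  shows "\<phi> y [^] q = y [^] p"
proof -
  have H1: "subgroup H1 G" using commens_dom[OF c] by (rule fi_subgroup)
  have [simp]: "x \<in> carrier G" "y \<in> carrier G" "\<phi> x \<in> carrier G" "\<phi> y \<in> carrier G"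
    using H1 x y commens_closed[OF c] by (auto intro: subgroup.mem_carrier)
  have xy: "x \<otimes> y \<in> H1" using H1 x(1) y by (rule subgroup.m_closed)
  obtain r s :: int where rs: "0 < r" "0 < s" "\<phi> y [^] s = y [^] r" using scales[OF y] by blast
  obtain u v :: int where uv: "0 < u" "0 < v" "\<phi> (x \<otimes> y) [^] v = (x \<otimes> y) [^] u"
    using scales[OF xy] by blast
  have comm': "\<phi> x \<otimes> \<phi> y = \<phi> y \<otimes> \<phi> x"
    using commens_mult[OF c x(1) y] commens_mult[OF c y x(1)] comm by simp
  define N where "N = q * s * v"
  have "x [^] (p * s * v) \<otimes> y [^] (r * q * v) = (x [^] p) [^] (s * v) \<otimes> (y [^] r) [^] (q * v)"
    by (simp add: int_pow_pow mult.assoc)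
  also have "\<dots> = \<phi> x [^] N \<otimes> \<phi> y [^] N"
    unfolding pq(1)[symmetric] rs(3)[symmetric] by (simp add: int_pow_pow N_def mult_ac)
  also have "\<dots> = \<phi> (x \<otimes> y) [^] N"
    unfolding commens_mult[OF c x(1) y] by (rule int_pow_mult_distrib[OF comm', symmetric]) simp_all
  also have "\<dots> = (\<phi> (x \<otimes> y) [^] v) [^] (q * s)"
    using commens_closed[OF c xy] by (simp add: int_pow_pow N_def mult_ac)
  also have "\<dots> = (x \<otimes> y) [^] (u * (q * s))" by (simp add: uv(3) int_pow_pow)
  also have "\<dots> = x [^] (u * (q * s)) \<otimes> y [^] (u * (q * s))"
    by (rule int_pow_mult_distrib[OF comm]) simp_all
  finally have eq: "x [^] (p * s * v) \<otimes> y [^] (r * q * v)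
      = x [^] (u * (q * s)) \<otimes> y [^] (u * (q * s))" .
  define d where "d = p * s * v - u * (q * s)"
  define e where "e = u * (q * s) - r * q * v"
  have "x [^] d = x [^] (- (u * (q * s)) + p * s * v)" by (simp add: d_def)
  also have "\<dots> = inv (x [^] (u * (q * s))) \<otimes> x [^] (p * s * v)"
    by (simp only: int_pow_mult int_pow_neg \<open>x \<in> carrier G\<close>)
  also have "x [^] (p * s * v)
      = x [^] (u * (q * s)) \<otimes> y [^] (u * (q * s)) \<otimes> inv (y [^] (r * q * v))"
    using eq by (simp add: inv_solve_right)
  also have "inv (x [^] (u * (q * s))) \<otimes> \<dots> = y [^] (u * (q * s)) \<otimes> inv (y [^] (r * q * v))"
    by (simp add: m_assoc cancel_inv_left)
  also have "\<dots> = y [^] e" by (simp add: e_def int_pow_diff)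
  finally have xd: "x [^] d = y [^] e" .
  show ?thesis
  proof (cases "d = 0")
    case True
    then have "y [^] e = \<one>" using xd by simp
    then consider "e = 0" | "y = \<one>" using torsion_free[of y e] by auto
    then show ?thesis
    proof cases
      case 1
      then have "p * s * v = r * q * v" using True unfolding d_def e_def by linarith
      then have ps: "p * s = r * q" using uv(2) by (metis less_irrefl mult_right_cancel)
      have "(\<phi> y [^] q) [^] s = (\<phi> y [^] s) [^] q" by (simp add: int_pow_pow mult.commute)
      also have "\<dots> = (y [^] p) [^] s" by (simp add: rs(3) int_pow_pow ps)
      finally show ?thesis by (rule int_root_unique) (use rs in auto)
    next
      case 2
      then show ?thesis using commens_one[OF c] by simp
    qed
  next
    case False
    then have e: "e \<noteq> 0" using xd torsion_free[of x d] x(2) by auto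
    have "\<phi> x [^] d = \<phi> y [^] e"
      using commens_int_pow[OF c x(1), of d] commens_int_pow[OF c y, of e] xd by simp
    then have "(\<phi> y [^] q) [^] e = (\<phi> x [^] q) [^] d"
      by (metis int_pow_pow mult.commute \<open>\<phi> x \<in> carrier G\<close> \<open>\<phi> y \<in> carrier G\<close>)
    also have "\<dots> = (x [^] d) [^] p" by (simp add: pq(1) int_pow_pow mult.commute)
    also have "\<dots> = (y [^] p) [^] e" by (simp add: xd int_pow_pow mult.commute)
    finally show ?thesis by (rule int_root_unique) (use e in auto)
  qed
qed

text \<open>The argument uses twice that \<open>\<phi> u\<close> equals \<open>u\<close> up to a factor having a power in common with
  \<open>u\<close>. Comparing \<open>\<phi>\<close> of the conjugate of \<open>g\<close> by \<open>y\<close> with that conjugate shows that \<open>z = inv y \<otimes> \<phi> y\<close>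
  conjugates a power of \<open>g\<close> to a power of \<open>g\<close>, hence so does \<open>w = y\<^bsup>p-q\<^esup>\<close>, which is a power of \<open>z\<close>.
  Applying \<open>\<phi>\<close> to this relation, the ratio of \<open>g\<close> cancels: \<open>\<phi> w\<close> rescales \<open>g\<close> by the same factor as
  \<open>w\<close>. So \<open>t = inv w \<otimes> \<phi> w\<close> commutes with a power of \<open>g\<close>, and uniqueness of roots passes this on to
  \<open>g\<close>, and from \<open>t\<close> to \<open>y\<close>. It is here that \<open>p \<noteq> q\<close> is needed: a power of \<open>t\<close> is \<open>y\<close> to the
  \<open>(p - q)\<^sup>2\<close>.\<close>

lemma proportional_scaled_central:
  assumes c: "(H1, H2, \<phi>) \<in> commensurations G"
    and scales: "\<And>g. g \<in> H1 \<Longrightarrow> \<exists>(p::int) (q::int). 0 < p \<and> 0 < q \<and> \<phi> g [^] q = g [^] p"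
    and y: "y \<in> H1" and g: "g \<in> H1"
    and pq: "\<phi> y [^] (q::int) = y [^] (p::int)" "0 < q" "p \<noteq> q"
  shows "y \<otimes> g = g \<otimes> y"
proof -
  have H1: "subgroup H1 G" using commens_dom[OF c] by (rule fi_subgroup)
  have [simp]: "x \<in> carrier G" "\<phi> x \<in> carrier G" if "x \<in> H1" for x
    using H1 that commens_closed[OF c] by (auto intro: subgroup.mem_carrier)
  have conjH: "conjugate a b \<in> H1" and conjphi: "\<phi> (conjugate a b) = conjugate (\<phi> a) (\<phi> b)"
    if "a \<in> H1" "b \<in> H1" for a b
    using that subgroup.m_closed[OF H1] subgroup.m_inv_closed[OF H1]
    by (simp_all add: conjugate_def commens_mult[OF c] commens_inv[OF c])
  have powH: "a [^] (k::int) \<in> H1" if "a \<in> H1" for a k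
    using H1 that by (rule subgroup_int_pow_closed)
  define m where "m = p - q"
  have m: "m \<noteq> 0" using pq(3) by (simp add: m_def)
  have comm: "\<phi> a \<otimes> a = a \<otimes> \<phi> a" if a: "a \<in> H1" "\<phi> a [^] q = a [^] p" for a
  proof (rule commute_root)
    have "a [^] p \<otimes> a = a \<otimes> a [^] p" using a by (intro commute_int_pow) auto
    then show "\<phi> a [^] q \<otimes> a = a \<otimes> \<phi> a [^] q" using a by simp
  qed (use a pq in auto)
  obtain p1 q1 :: int where g1: "0 < p1" "0 < q1" "\<phi> g [^] q1 = g [^] p1" using scales[OF g] by blast
  have yg: "conjugate y g \<in> H1" using y g by (rule conjH)
  obtain p2 q2 :: int where g2: "0 < p2" "0 < q2" "\<phi> (conjugate y g) [^] q2 = conjugate y g [^] p2"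
    using scales[OF yg] by blast
  have "conjugate (\<phi> y) (g [^] (p1 * q2)) = conjugate (\<phi> y) ((\<phi> g [^] q1) [^] q2)"
    unfolding g1(3) using g by (simp add: int_pow_pow)
  also have "\<dots> = (\<phi> (conjugate y g) [^] q2) [^] q1"
    using y g by (simp add: conjphi conjugate_int_pow int_pow_pow mult.commute)
  also have "\<dots> = conjugate y (g [^] (p2 * q1))"
    unfolding g2(3) using y g by (simp add: conjugate_int_pow int_pow_pow)
  finally have line: "conjugate (\<phi> y) (g [^] (p1 * q2)) = conjugate y (g [^] (p2 * q1))" .
  define z where "z = inv y \<otimes> \<phi> y"
  have zG: "z \<in> carrier G" using y by (simp add: z_def)
  have "conjugate z (g [^] (p1 * q2)) = conjugate (inv y) (conjugate (\<phi> y) (g [^] (p1 * q2)))"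
    using y g by (simp add: z_def conjugate_conjugate)
  also have "\<dots> = g [^] (p2 * q1)" unfolding line using y g by (simp add: conjugate_conjugate)
  finally have z: "conjugate z (g [^] (p1 * q2)) = g [^] (p2 * q1)" .
  define a where "a = (p1 * q2) ^ nat q"
  define b where "b = (p2 * q1) ^ nat q"
  have a: "a \<noteq> 0" using g1 g2 by (simp add: a_def)
  define w where "w = y [^] m"
  have wH: "w \<in> H1" unfolding w_def using y by (rule powH)
  have "z [^] nat q = z [^] q" using pq(2) int_pow_int[of G z "nat q"] by simp
  also have "\<dots> = w"
    unfolding z_def w_def m_def using comm[OF y pq(1)] y pq(1) by (intro quotient_int_pow) auto
  finally have "conjugate w (g [^] a) = g [^] b"
    using conjugate_pow_scaling[OF z zG, of "nat q"] g by (simp add: a_def b_def)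
  have "\<phi> (conjugate w (g [^] a)) = \<phi> (g [^] b)" using \<open>conjugate w (g [^] a) = g [^] b\<close> by simp
  then have "conjugate (\<phi> w) (\<phi> g [^] a) = \<phi> g [^] b"
    using wH g powH by (simp add: conjphi commens_int_pow[OF c])
  then have "conjugate (\<phi> w) (\<phi> g [^] a) [^] q1 = (\<phi> g [^] b) [^] q1" by simp
  then have "conjugate (\<phi> w) ((\<phi> g [^] q1) [^] a) = (\<phi> g [^] q1) [^] b"
    using wH g by (simp add: conjugate_int_pow int_pow_pow mult.commute)
  then have "conjugate (\<phi> w) (g [^] a) [^] p1 = (g [^] b) [^] p1"
    unfolding g1(3) using wH g by (simp add: conjugate_int_pow int_pow_pow mult.commute)
  then have "conjugate (\<phi> w) (g [^] a) = g [^] b"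
    by (rule int_root_unique) (use wH g g1 in auto)
  then have same: "conjugate (\<phi> w) (g [^] a) = conjugate w (g [^] a)" using \<open>conjugate w (g [^] a) = g [^] b\<close> by simp
  define t where "t = inv w \<otimes> \<phi> w"
  have tG: "t \<in> carrier G" using wH by (simp add: t_def)
  have "conjugate t (g [^] a) = conjugate (inv w) (conjugate (\<phi> w) (g [^] a))" using wH g by (simp add: t_def conjugate_conjugate)
  also have "\<dots> = g [^] a" unfolding same using wH g by (simp add: conjugate_conjugate)
  finally have "t \<otimes> g [^] a = g [^] a \<otimes> t" using tG g by (simp add: conjugate_eq_iff)
  then have tg: "t \<otimes> g = g \<otimes> t" using commute_root[of g a t] a tG g by simp
  have wp: "\<phi> w [^] q = w [^] p"
  proof -
    have "\<phi> w [^] q = (\<phi> y [^] q) [^] m"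
      using y by (simp add: w_def commens_int_pow[OF c] int_pow_pow mult.commute)
    then show ?thesis unfolding pq(1) w_def using y by (simp add: int_pow_pow mult.commute)
  qed
  have "t [^] q = w [^] m"
    unfolding t_def m_def using comm[OF wH wp] wH wp by (intro quotient_int_pow) auto
  also have "\<dots> = y [^] (m * m)" using y by (simp add: w_def int_pow_pow)
  finally have "y [^] (m * m) \<otimes> g = g \<otimes> y [^] (m * m)"
    using commute_int_pow[OF tG _ tg, of q] g by simp
  then show ?thesis by (rule commute_root) (use m y g in auto)
qed

text \<open>If the ratio of \<open>y\<close> were not 1, then \<open>y\<close> would be central, hence share its ratio with the
  non-central element \<open>a\<close>, which is impossible. A ratio of 1 means \<open>\<phi> y = y\<close> by uniqueness of roots.\<close>

lemma proportional_nonabelian_id: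
  assumes c: "(H1, H2, \<phi>) \<in> commensurations G"
    and scales: "\<And>g. g \<in> H1 \<Longrightarrow> \<exists>(p::int) (q::int). 0 < p \<and> 0 < q \<and> \<phi> g [^] q = g [^] p"
    and ab: "a \<in> H1" "b \<in> H1" "a \<otimes> b \<noteq> b \<otimes> a"
    and y: "y \<in> H1"
  shows "\<phi> y = y"
proof (cases "y = \<one>")
  case True
  then show ?thesis using commens_one[OF c] by simp
next
  case False
  have [simp]: "x \<in> carrier G" "\<phi> x \<in> carrier G" if "x \<in> H1" for x
    using that fi_subset[OF commens_dom[OF c]] commens_closed[OF c] by auto
  obtain p q :: int where pq: "0 < p" "0 < q" "\<phi> y [^] q = y [^] p" using scales[OF y] by blast
  have "p = q"
  proof (rule ccontr)
    assume ne: "p \<noteq> q"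
    have "y \<otimes> a = a \<otimes> y" using proportional_scaled_central[OF c scales y ab(1) pq(3,2) ne] .
    then have "\<phi> a [^] q = a [^] p" using proportional_commuting[OF c scales y False ab(1) _ pq(3,2)] by blast
    then have "a \<otimes> b = b \<otimes> a" using proportional_scaled_central[OF c scales ab(1,2) _ pq(2) ne] by blast
    then show False using ab(3) by simp
  qed
  then have "\<phi> y [^] q = y [^] q" using pq(3) by simp
  then show ?thesis by (rule int_root_unique) (use pq y in auto)
qed

lemma proportional_abelian_constant:
  assumes c: "(H1, H2, \<phi>) \<in> commensurations G"
    and scales: "\<And>g. g \<in> H1 \<Longrightarrow> \<exists>(p::int) (q::int). 0 < p \<and> 0 < q \<and> \<phi> g [^] q = g [^] p"
    and comm: "\<And>x y. x \<in> H1 \<Longrightarrow> y \<in> H1 \<Longrightarrow> x \<otimes> y = y \<otimes> x"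
  shows "\<exists>(p::int) (q::int). 0 < p \<and> 0 < q \<and> (\<forall>g\<in>H1. \<phi> g [^] q = g [^] p)"
proof (cases "\<exists>x\<in>H1. x \<noteq> \<one>")
  case True
  then obtain x where x: "x \<in> H1" "x \<noteq> \<one>" by blast
  obtain p q :: int where pq: "0 < p" "0 < q" "\<phi> x [^] q = x [^] p" using scales[OF x(1)] by blast
  have "\<forall>g\<in>H1. \<phi> g [^] q = g [^] p"
    using proportional_commuting[OF c scales x _ comm pq(3,2)] x(1) by blast
  then show ?thesis using pq by blast
next
  case False
  then have "\<phi> g [^] (1::int) = g [^] (1::int)" if "g \<in> H1" for g
    using that commens_one[OF c] by auto
  then show ?thesis using zero_less_one by blast
qed

text \<open>Powers of \<open>x\<close> and \<open>y\<close> lie in an abelian subgroup of finite index, and elements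
  commute as soon as some of their powers do.\<close>

lemma virtually_abelian_imp_commute:
  assumes va: "virtually_abelian G" and x: "x \<in> carrier G" and y: "y \<in> carrier G"
  shows "x \<otimes> y = y \<otimes> x"
proof -
  obtain H where H: "fi H" "comm_group (G\<lparr>carrier := H\<rparr>)" using va unfolding virtually_abelian_def by blast
  obtain n :: nat where n: "0 < n" "x [^] n \<in> H" using fi_power_mem[OF H(1) x] .
  obtain m :: nat where m: "0 < m" "y [^] m \<in> H" using fi_power_mem[OF H(1) y] .
  have comm: "a \<otimes> b = b \<otimes> a" if "a \<in> H" "b \<in> H" for a b
    using comm_group.axioms(1)[OF H(2)] comm_monoid.m_comm[of "G\<lparr>carrier := H\<rparr>" a b] that by simp
  have "x [^] int n \<otimes> y [^] m = y [^] m \<otimes> x [^] int n" using comm[OF n(2) m(2)] by (simp add: int_pow_int)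
  then have "x \<otimes> y [^] m = y [^] m \<otimes> x" by (rule commute_root) (use n x y in auto)
  then have "y [^] int m \<otimes> x = x \<otimes> y [^] int m" by (simp add: int_pow_int)
  then have "y \<otimes> x = x \<otimes> y" by (rule commute_root) (use m x y in auto)
  then show ?thesis by simp
qed

section \<open>The kernel of the action\<close>

lemma kernel_imp_proportional:
  assumes c: "(H1, H2, \<phi>) \<in> commensurations G"
    and k: "comm_act G (comm_class G (H1, H2, \<phi>)) = \<one>\<^bsub>BijGroup (VLO G)\<^esub>"
    and g: "g \<in> H1"
  shows "\<exists>(p::int) (q::int). 0 < p \<and> 0 < q \<and> \<phi> g [^] q = g [^] p"
proof -
  have "(push_cone (H1, H2, \<phi>) v, v) \<in> vlo_rel G" if "v \<in> virtual_cones G" for v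
    using k that unfolding comm_act_kernel_iff[OF c] by blast
  then obtain p q :: nat where pq: "0 < p" "0 < q" "\<phi> g [^] q = g [^] p"
    using fixes_cones_imp_proportional[OF c _ g] by blast
  then have "0 < int p" "0 < int q" "\<phi> g [^] int q = g [^] int p" by (simp_all add: int_pow_int)
  then show ?thesis by blast
qed

theorem comm_act_faithful:
  assumes nva: "\<not> virtually_abelian G"
  shows "faithful_action (Comm G) (VLO G) (comm_act G)"
proof -
  have act: "group_action (Comm G) (VLO G) (comm_act G)" by (rule comm_act_group_action)
  then interpret act: group_hom "Comm G" "BijGroup (VLO G)" "comm_act G"
    by (rule group_action.group_hom)
  have "C = \<one>\<^bsub>Comm G\<^esub>"
    if C: "C \<in> carrier (Comm G)" "comm_act G C = \<one>\<^bsub>BijGroup (VLO G)\<^esub>" for C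
  proof -
    obtain H1 H2 \<phi> where c: "(H1, H2, \<phi>) \<in> commensurations G" and CC: "C = comm_class G (H1, H2, \<phi>)"
      using C(1) by (auto simp: Comm_carrier)
    have scales: "\<exists>(p::int) (q::int). 0 < p \<and> 0 < q \<and> \<phi> g [^] q = g [^] p" if "g \<in> H1" for g
      using kernel_imp_proportional[OF c C(2)[unfolded CC] that] .
    have H1: "fi H1" using commens_dom[OF c] .
    have "\<not> comm_group (G\<lparr>carrier := H1\<rparr>)" using nva H1 unfolding virtually_abelian_def by blast
    then obtain a b where ab: "a \<in> H1" "b \<in> H1" "a \<otimes> b \<noteq> b \<otimes> a"
      using group.group_comm_groupI[OF subgroup.subgroup_is_group[OF fi_subgroup[OF H1] is_group]]
      by auto
    have "\<phi> y = id y" if "y \<in> H1" for y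
      using proportional_nonabelian_id[OF c scales ab that] by simp
    then show ?thesis
      unfolding CC Comm_one using fi_subset[OF H1]
      by (intro comm_class_eqI[OF c commens_id H1]) auto
  qed
  then have "inj_on (comm_act G) (carrier (Comm G))" by (simp add: act.inj_on_one_iff)
  then show ?thesis using act by (simp add: faithful_action_def faithful_action_axioms_def)
qed

text \<open>On the elements \<open>\<phi> x\<close> of \<open>H\<close> with \<open>x\<close> in \<open>H\<close>, the signs of \<open>\<phi> x\<close> and \<open>x\<close> agree, being
  the sign of the common power \<open>(\<phi> x)\<^sup>q = x\<^sup>p\<close>.\<close>

lemma tau_fixes_cones:
  assumes c: "(H1, H2, \<phi>) \<in> commensurations G" and pq: "0 < p" "0 < q"
    and tau: "is_tau G p q H1 H2 \<phi>" and v: "v \<in> virtual_cones G"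
  shows "(push_cone (H1, H2, \<phi>) v, v) \<in> vlo_rel G"
proof -
  obtain H P where vv: "v = (H, P)" by (cases v) auto
  have H: "fi H" and P: "is_cone H P" using v unfolding vv virtual_cones_iff by auto
  have fiK: "fi (\<phi> ` (H \<inter> H1) \<inter> H)"
    using commens_image_fi[OF c fi_Int[OF H commens_dom[OF c]]] H by (intro fi_Int) auto
  have "\<phi> x \<in> \<phi> ` (P \<inter> H1) \<longleftrightarrow> \<phi> x \<in> P" if x: "x \<in> H" "x \<in> H1" "\<phi> x \<in> H" for x
  proof -
    have xG: "x \<in> carrier G" using x(1) fi_subset[OF H] by blast
    have "\<phi> x [^] q = x [^] p"
      using tau x(2) commens_nat_pow[OF c x(2), of q] by (simp add: is_tau_def)
    then have "\<phi> x \<in> P \<longleftrightarrow> x \<in> P"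
      using cone_nat_pow_iff[OF P x(1) xG pq(1)]
        cone_nat_pow_iff[OF P x(3) commens_closed[OF c x(2)] pq(2)] by simp
    moreover have "\<phi> x \<in> \<phi> ` (P \<inter> H1) \<longleftrightarrow> x \<in> P \<inter> H1"
      using commens_inj[OF c] x(2) by (intro inj_on_image_mem_iff) auto
    ultimately show ?thesis using x(2) by simp
  qed
  then have "y \<in> \<phi> ` (P \<inter> H1) \<longleftrightarrow> y \<in> P" if "y \<in> \<phi> ` (H \<inter> H1) \<inter> H" for y
    using that by (auto simp del: image_iff)
  then have "\<phi> ` (P \<inter> H1) \<inter> (\<phi> ` (H \<inter> H1) \<inter> H) = P \<inter> (\<phi> ` (H \<inter> H1) \<inter> H)" by auto
  then show ?thesis
    using fiK push_cone_closed[OF c v] v unfolding vv push_cone.simps vlo_rel_iff by blast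
qed

theorem comm_act_kernel_abelian:
  assumes va: "virtually_abelian G"
  shows "kernel (Comm G) (BijGroup (VLO G)) (comm_act G) =
    {comm_class G (H1, H2, \<phi>) | H1 H2 \<phi> p q.
       finite_index_subgroup H1 G \<and> comm_group (G\<lparr>carrier := H1\<rparr>) \<and>
       finite_index_subgroup H2 G \<and> comm_group (G\<lparr>carrier := H2\<rparr>) \<and>
       0 < p \<and> 0 < q \<and> is_tau G p q H1 H2 \<phi>}" (is "_ = ?T")
proof
  have comm: "x \<otimes> y = y \<otimes> x" if "fi H" "x \<in> H" "y \<in> H" for H x y
    using virtually_abelian_imp_commute[OF va] fi_subset[OF that(1)] that(2,3) by blast
  have ab: "comm_group (G\<lparr>carrier := H\<rparr>)" if H: "fi H" for H
    using group.group_comm_groupI[OF subgroup.subgroup_is_group[OF fi_subgroup[OF H] is_group]] comm[OF H]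
    by simp
  show "kernel (Comm G) (BijGroup (VLO G)) (comm_act G) \<subseteq> ?T"
  proof
    fix C assume C: "C \<in> kernel (Comm G) (BijGroup (VLO G)) (comm_act G)"
    then obtain H1 H2 \<phi> where c: "(H1, H2, \<phi>) \<in> commensurations G" and CC: "C = comm_class G (H1, H2, \<phi>)"
      by (auto simp: kernel_def Comm_carrier)
    have k: "comm_act G (comm_class G (H1, H2, \<phi>)) = \<one>\<^bsub>BijGroup (VLO G)\<^esub>"
      using C by (simp add: kernel_def CC)
    obtain p q :: int where pq: "0 < p" "0 < q" "\<forall>g\<in>H1. \<phi> g [^] q = g [^] p"
      using proportional_abelian_constant[OF c kernel_imp_proportional[OF c k] comm[OF commens_dom[OF c]]]
      by blast
    have "\<phi> (g [^] nat q) = g [^] nat p" if "g \<in> H1" for g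
    proof -
      have "\<phi> (g [^] nat q) = \<phi> g [^] int (nat q)"
        using commens_nat_pow[OF c that] by (simp add: int_pow_int)
      also have "\<dots> = g [^] int (nat p)" using pq that by simp
      finally show ?thesis by (simp only: int_pow_int)
    qed
    then have "is_tau G (nat p) (nat q) H1 H2 \<phi>" using c by (simp add: is_tau_def commensurations_def)
    moreover have "0 < nat p" "0 < nat q" using pq by simp_all
    ultimately show "C \<in> ?T"
      using ab[OF commens_dom[OF c]] ab[OF commens_cod[OF c]] commens_dom[OF c] commens_cod[OF c]
      unfolding CC by blast
  qed
  show "?T \<subseteq> kernel (Comm G) (BijGroup (VLO G)) (comm_act G)"
  proof
    fix C assume "C \<in> ?T"
    then obtain H1 H2 \<phi> p q where CC: "C = comm_class G (H1, H2, \<phi>)" and "fi H1" "fi H2"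
      and pq: "0 < p" "0 < q" and tau: "is_tau G p q H1 H2 \<phi>" by blast
    then have c: "(H1, H2, \<phi>) \<in> commensurations G" by (simp add: commensurations_def is_tau_def)
    have "comm_act G C = \<one>\<^bsub>BijGroup (VLO G)\<^esub>"
      unfolding CC comm_act_kernel_iff[OF c] using tau_fixes_cones[OF c pq tau] by blast
    then show "C \<in> kernel (Comm G) (BijGroup (VLO G)) (comm_act G)"
      using c by (auto simp: kernel_def Comm_carrier CC)
  qed
qed

end

theorem theorem4p3:
  fixes G :: "('a, 'b) monoid_scheme"
  assumes "group G" and "bi_orderable G"
  shows "(\<not> virtually_abelian G \<longrightarrow> faithful_action (Comm G) (VLO G) (comm_act G)) \<and>
    (virtually_abelian G \<longrightarrow>
       group_action (Comm G) (VLO G) (comm_act G) \<and>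
       kernel (Comm G) (BijGroup (VLO G)) (comm_act G) =
         {comm_class G (H1, H2, \<phi>) | H1 H2 \<phi> p q.
            finite_index_subgroup H1 G \<and> comm_group (G\<lparr>carrier := H1\<rparr>) \<and>
            finite_index_subgroup H2 G \<and> comm_group (G\<lparr>carrier := H2\<rparr>) \<and>
            0 < p \<and> 0 < q \<and> is_tau G p q H1 H2 \<phi>})"
proof -
  obtain lt where "bi_ordering G lt" using assms(2) by (auto simp: bi_orderable_def)
  then interpret bi_ordered_group G lt
    by (intro bi_ordered_group.intro bi_ordered_group_axioms.intro assms(1))
  show ?thesis
    by (intro conjI impI comm_act_faithful comm_act_group_action comm_act_kernel_abelian)
qed

end
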